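(* Let $G$ be a group equipped with a conjugation-invariant norm. (a) If $G$ is countable then, for any scaling set $T$, $\hat{\mathcal{C}}(G,T)$ is separable, i.e. it is a Polish group. (b) $\hat{\mathcal{C}}(G)$ is contractible. The contraction is through a continuous family of Lipschitz homomorphisms $\varphi_t\colon\hat{\mathcal{C}}(G)\to\hat{\mathcal{C}}(G)$ indexed by $t\in[0,1]$; that is, there is a continuous map $[0,1]\times\hat{\mathcal{C}}(G)\to\hat{\mathcal{C}}(G)$, $(t,x)\mapsto\varphi_t(x)$, such that each $\varphi_t$ is a Lipschitz homomorphism, $\varphi_1$ is the identity and $\varphi_0$ is the trivial homomorphism.
   Context: Norms. A norm on a group $G$ is a function $\|\cdot\|\colon G\to[0,\infty)$ with $\|g\|=0\iff g=1$, $\|g^{-1}\|=\|g\|$ and $\|gh\|\le\|g\|+\|h\|$; for a pseudonorm one only requires $\|1\|=0$ instead of the first condition. It is conjugation-invariant if $\|hgh^{-1}\|=\|g\|$ for all $g,h$. It induces the bi-invariant (pseudo)metric $d(g,h)=\|g^{-1}h\|$, making the group a topological group; all metric and topological notions refer to it. A homomorphism $\varphi$ is Lipschitz with constant $C$ iff $\|\varphi(g)\|\le C\|g\|$ for all $g$. The groups $F_{\mathbb{R}}(G)$ and $F(G)$. Let $G$ be a group with a conjugation-invariant norm. $F_{\mathbb{R}}(G)$ is the free product of copies of the additive group $\mathbb{R}$ indexed by the elements $g$ of the set $G$; the element $r$ of the copy indexed by $g$ is written $\overline{g}(r)$. It carries the conjugation-invariant pseudonorm $$\|x\|=\inf\Big\{\sum_{i=1}^n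 |r_i|\,\|g_i\| : x=\prod_{i=1}^n h_i\,\overline{g_i}(r_i)^{\pm1}h_i^{-1},\ h_i\in F_{\mathbb{R}}(G)\Big\}.$$ $F(G)\le F_{\mathbb{R}}(G)$ is the subgroup generated by the elements $\overline{g}:=\overline{g}(1)$; it is free on $\{\overline{g}: g\in G\}$. For $t\in\mathbb{R}$, $\psi_t\colon F_{\mathbb{R}}(G)\to F_{\mathbb{R}}(G)$ is the homomorphism with $\psi_t(\overline{g}(r))=\overline{g}(tr)$. $\pi\colon F(G)\to G$ is the homomorphism with $\pi(\overline{g})=g$. Directional asymptotic cone. A scaling set is an unbounded subset $T\subseteq(0,\infty)$; limits over $t\in T$ are taken as $t\to\infty$. A function $f$ from $T$ to a pseudometric space is Cauchy if for every $\epsilon>0$, $d(f(t),f(t'))<\epsilon$ for all sufficiently large $t,t'\in T$. $\mathcal{D}(G,T)$ is the group (pointwise product) of all functions $w\colon T\to F(G)$ such that $t\mapsto\psi_{1/t}(w(t))\in F_{\mathbb{R}}(G)$ is Cauchy, with pseudonorm $\|w\|=\lim_{t\in T}\|\psi_{1/t}(w(t))\|$. $\mathcal{C}(G,T)=\{\pi\circ w: w\in\mathcal{D}(G,T)\}$, a group of functions $T\to G$, with pseudonorm $\|g\|=\inf\{\|w\|: w\in\mathcal{D}(G,T),\ \pi\circ w=g\}$. The directional asymptotic cone $\hat{\mathcal{C}}(G,T)$ is the quotient of $\mathcal{C}(G,T)$ by the normal subgroup of elements of pseudonorm $0$, with the induced conjugation-invariant norm. Write $\hat{\mathcal{C}}(G)=\hat{\mathcal{C}}(G,(0,\infty))$.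 *)

theory Defs
  imports "HOL-Analysis.Analysis" "HOL-Algebra.Product_Groups"
begin

section \<open>Conjugation-invariant norms\<close>

locale conj_norm_group = group G for G (structure) +
  fixes N :: "'a \<Rightarrow> real"
  assumes norm_nonneg: "g \<in> carrier G \<Longrightarrow> 0 \<le> N g"
    and norm_eq_0_iff: "g \<in> carrier G \<Longrightarrow> N g = 0 \<longleftrightarrow> g = \<one>"
    and norm_inv: "g \<in> carrier G \<Longrightarrow> N (inv g) = N g"
    and norm_mult_le: "\<lbrakk>g \<in> carrier G; h \<in> carrier G\<rbrakk> \<Longrightarrow> N (g \<otimes> h) \<le> N g + N h"
    and norm_conj: "\<lbrakk>g \<in> carrier G; h \<in> carrier G\<rbrakk> \<Longrightarrow> N (h \<otimes> g \<otimes> inv h) = N g"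

text \<open>The library's \<^locale>\<open>Metric_space\<close> asks for nonnegativity and symmetry on the whole type,
  hence the dummy value outside the carrier.\<close>

definition norm_dist :: "('a, 'm) monoid_scheme \<Rightarrow> ('a \<Rightarrow> real) \<Rightarrow> 'a \<Rightarrow> 'a \<Rightarrow> real" where
  "norm_dist G N x y =
     (if x \<in> carrier G \<and> y \<in> carrier G then N (inv\<^bsub>G\<^esub> x \<otimes>\<^bsub>G\<^esub> y) else 0)"

definition norm_topology :: "('a, 'm) monoid_scheme \<Rightarrow> ('a \<Rightarrow> real) \<Rightarrow> 'a topology" where
  "norm_topology G N = Metric_space.mtopology (carrier G) (norm_dist G N)"

definition lipschitz_hom :: "('a, 'm) monoid_scheme \<Rightarrow> ('a \<Rightarrow> real) \<Rightarrow>
    ('b, 'n) monoid_scheme \<Rightarrow> ('b \<Rightarrow> real) \<Rightarrow> ('a \<Rightarrow> 'b) \<Rightarrow> bool" where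
  "lipschitz_hom G N H M f \<longleftrightarrow>
     f \<in> hom G H \<and> (\<exists>C. \<forall>x\<in>carrier G. M (f x) \<le> C * N x)"

section \<open>Topological and Polish groups\<close>

definition topological_group_on :: "('a, 'm) monoid_scheme \<Rightarrow> 'a topology \<Rightarrow> bool" where
  "topological_group_on G X \<longleftrightarrow>
     group G \<and> topspace X = carrier G \<and>
     continuous_map (prod_topology X X) X (\<lambda>(x, y). x \<otimes>\<^bsub>G\<^esub> y) \<and>
     continuous_map X X (\<lambda>x. inv\<^bsub>G\<^esub> x)"

definition separable_top :: "'a topology \<Rightarrow> bool" where
  "separable_top X \<longleftrightarrow> (\<exists>S. countable S \<and> S \<subseteq> topspace X \<and> X closure_of S = topspace X)"

definition polish_group :: "('a, 'm) monoid_scheme \<Rightarrow> 'a topology \<Rightarrow> bool" where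
  "polish_group G X \<longleftrightarrow>
     topological_group_on G X \<and> separable_top X \<and> completely_metrizable_space X"

section \<open>The free product of copies of the reals\<close>

text \<open>Elements of the free product are represented by their normal forms: the pair \<open>(g, r)\<close> stands
  for the element \<open>r\<close> of the copy indexed by \<open>g\<close>; in a reduced word no exponent is \<open>0\<close> and
  neighbouring letters come from different copies.\<close>

type_synonym 'a word = "('a \<times> real) list"

definition reduced_word :: "'a set \<Rightarrow> 'a word \<Rightarrow> bool" where
  "reduced_word S w \<longleftrightarrow> set w \<subseteq> S \<times> (- {0}) \<and> distinct_adj (map fst w)"

fun word_cons :: "'a \<Rightarrow> real \<Rightarrow> 'a word \<Rightarrow> 'a word" where
  "word_cons g r [] = (if r = 0 then [] else [(g, r)])"
| "word_cons g r ((h, s) # w) =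
     (if r = 0 then (h, s) # w
      else if g \<noteq> h then (g, r) # (h, s) # w
      else if r + s = 0 then w
      else (g, r + s) # w)"

definition free_product_real :: "'a set \<Rightarrow> 'a word monoid" where
  "free_product_real S =
     \<lparr>carrier = {w. reduced_word S w},
      monoid.mult = (\<lambda>u v. foldr (\<lambda>(g, r). word_cons g r) u v),
      one = []\<rparr>"

text \<open>The element of the copy indexed by \<open>g\<close> given by the real number \<open>r\<close>.\<close>

definition letter :: "'a \<Rightarrow> real \<Rightarrow> 'a word" where
  "letter g r = word_cons g r []"

text \<open>The map out of the free product determined by its values on the letters;
  see \<open>lift_hom\<close> and \<open>lift_letter\<close> below.\<close>

definition lift_map :: "('b, 'm) monoid_scheme \<Rightarrow> ('a \<Rightarrow> real \<Rightarrow> 'b) \<Rightarrow> 'a word \<Rightarrow> 'b" where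
  "lift_map H f w = foldr (\<lambda>(g, r) y. f g r \<otimes>\<^bsub>H\<^esub> y) w \<one>\<^bsub>H\<^esub>"

abbreviation FR :: "('a, 'm) monoid_scheme \<Rightarrow> 'a word monoid" where
  "FR G \<equiv> free_product_real (carrier G)"

definition FR_norm :: "('a, 'm) monoid_scheme \<Rightarrow> ('a \<Rightarrow> real) \<Rightarrow> 'a word \<Rightarrow> real" where
  "FR_norm G N x = Inf {(\<Sum>(h, g, r, e)\<leftarrow>ps. \<bar>r\<bar> * N g) | ps.
     (\<forall>(h, g, r, e)\<in>set ps. h \<in> carrier (FR G) \<and> g \<in> carrier G \<and> e \<in> {1, -1 :: int}) \<and>
     x = foldr (\<otimes>\<^bsub>FR G\<^esub>)
           (map (\<lambda>(h, g, r, e). h \<otimes>\<^bsub>FR G\<^esub> (letter g r [^]\<^bsub>FR G\<^esub> e) \<otimes>\<^bsub>FR G\<^esub> inv\<^bsub>FR G\<^esub> h) ps)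
           \<one>\<^bsub>FR G\<^esub>}"

definition free_grp :: "('a, 'm) monoid_scheme \<Rightarrow> 'a word monoid" where
  "free_grp G = subgroup_generated (FR G) ((\<lambda>g. letter g 1) ` carrier G)"

definition psi :: "('a, 'm) monoid_scheme \<Rightarrow> real \<Rightarrow> 'a word \<Rightarrow> 'a word" where
  "psi G t = lift_map (FR G) (\<lambda>g r. letter g (t * r))"

text \<open>The words in \<^term>\<open>free_grp G\<close> have integer exponents, so the floor is only a type conversion
  there; \<open>proj_hom\<close> and \<open>proj_letter\<close> below characterise the map.\<close>

definition proj :: "('a, 'm) monoid_scheme \<Rightarrow> 'a word \<Rightarrow> 'a" where
  "proj G = lift_map G (\<lambda>g r. g [^]\<^bsub>G\<^esub> \<lfloor>r\<rfloor>)"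

section \<open>The directional asymptotic cone\<close>

definition scaling_set :: "real set \<Rightarrow> bool" where
  "scaling_set T \<longleftrightarrow> T \<subseteq> {0<..} \<and> \<not> bounded T"

definition D_group :: "('a, 'm) monoid_scheme \<Rightarrow> ('a \<Rightarrow> real) \<Rightarrow> real set \<Rightarrow> (real \<Rightarrow> 'a word) monoid" where
  "D_group G N T = (product_group T (\<lambda>_. free_grp G))
     \<lparr>carrier := {w \<in> carrier (product_group T (\<lambda>_. free_grp G)).
        \<forall>\<epsilon>>0. \<exists>M. \<forall>t\<in>T. \<forall>t'\<in>T. t \<ge> M \<longrightarrow> t' \<ge> M \<longrightarrow>
          norm_dist (FR G) (FR_norm G N) (psi G (1 / t) (w t)) (psi G (1 / t') (w t')) < \<epsilon>}\<rparr>"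

definition D_norm :: "('a, 'm) monoid_scheme \<Rightarrow> ('a \<Rightarrow> real) \<Rightarrow> real set \<Rightarrow> (real \<Rightarrow> 'a word) \<Rightarrow> real" where
  "D_norm G N T w = Lim (inf at_top (principal T)) (\<lambda>t. FR_norm G N (psi G (1 / t) (w t)))"

definition C_group :: "('a, 'm) monoid_scheme \<Rightarrow> ('a \<Rightarrow> real) \<Rightarrow> real set \<Rightarrow> (real \<Rightarrow> 'a) monoid" where
  "C_group G N T = (product_group T (\<lambda>_. G))
     \<lparr>carrier := {restrict (proj G \<circ> w) T | w. w \<in> carrier (D_group G N T)}\<rparr>"

definition C_norm :: "('a, 'm) monoid_scheme \<Rightarrow> ('a \<Rightarrow> real) \<Rightarrow> real set \<Rightarrow> (real \<Rightarrow> 'a) \<Rightarrow> real" where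
  "C_norm G N T g =
     Inf {D_norm G N T w | w. w \<in> carrier (D_group G N T) \<and> restrict (proj G \<circ> w) T = g}"

definition asym_cone :: "('a, 'm) monoid_scheme \<Rightarrow> ('a \<Rightarrow> real) \<Rightarrow> real set \<Rightarrow> (real \<Rightarrow> 'a) set monoid" where
  "asym_cone G N T = C_group G N T Mod {g \<in> carrier (C_group G N T). C_norm G N T g = 0}"

text \<open>The pseudonorm is constant on each coset.\<close>

definition cone_norm :: "('a, 'm) monoid_scheme \<Rightarrow> ('a \<Rightarrow> real) \<Rightarrow> real set \<Rightarrow> (real \<Rightarrow> 'a) set \<Rightarrow> real" where
  "cone_norm G N T X = the_elem (C_norm G N T ` X)"

abbreviation cone_topology :: "('a, 'm) monoid_scheme \<Rightarrow> ('a \<Rightarrow> real) \<Rightarrow> real set \<Rightarrow> (real \<Rightarrow> 'a) set topology" where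
  "cone_topology G N T \<equiv> norm_topology (asym_cone G N T) (cone_norm G N T)"

section \<open>Basic facts on the free product\<close>

lemma free_product_real_simps [simp]:
  "w \<in> carrier (free_product_real S) \<longleftrightarrow> reduced_word S w"
  "u \<otimes>\<^bsub>free_product_real S\<^esub> v = foldr (\<lambda>(g, r). word_cons g r) u v"
  "\<one>\<^bsub>free_product_real S\<^esub> = []"
  by (simp_all add: free_product_real_def)

lemma reduced_Nil [simp]: "reduced_word S []"
  by (simp add: reduced_word_def)

lemma reduced_Cons:
  "reduced_word S ((g, r) # w) \<longleftrightarrow>
     g \<in> S \<and> r \<noteq> 0 \<and> reduced_word S w \<and> (w = [] \<or> g \<noteq> fst (hd w))"
  by (cases w) (auto simp: reduced_word_def)

lemma reduced_word_cons: "reduced_word S w \<Longrightarrow> g \<in> S \<Longrightarrow> reduced_word S (word_cons g r w)"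
  by (cases "(g, r, w)" rule: word_cons.cases) (auto simp: reduced_Cons)

lemma reduced_letter: "g \<in> S \<Longrightarrow> reduced_word S (letter g r)"
  unfolding letter_def by (rule reduced_word_cons) simp_all

lemma word_cons_0 [simp]: "word_cons g 0 w = w"
  by (cases w) auto

lemma word_cons_reduced: "reduced_word S ((g, r) # w) \<Longrightarrow> word_cons g r w = (g, r) # w"
  by (cases w) (auto simp: reduced_Cons)

lemma word_cons_word_cons:
  "reduced_word S w \<Longrightarrow> word_cons g r (word_cons g s w) = word_cons g (r + s) w"
proof (cases w)
  case (Cons p v)
  obtain h q where p: "p = (h, q)" by (cases p)
  assume "reduced_word S w"
  then have q: "q \<noteq> 0" and v: "v = [] \<or> h \<noteq> fst (hd v)" by (auto simp: Cons p reduced_Cons)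
  consider "v = []" | h' q' v' where "v = (h', q') # v'" by (cases v) auto
  then show ?thesis
    using q v by cases (auto simp: Cons p algebra_simps add_eq_0_iff)
qed auto

lemma reduced_mult:
  "reduced_word S u \<Longrightarrow> reduced_word S v \<Longrightarrow> reduced_word S (foldr (\<lambda>(g, r). word_cons g r) u v)"
  by (induction u) (auto simp: reduced_Cons reduced_word_cons)

lemma mult_word_cons:
  assumes "reduced_word S u" "reduced_word S v"
  shows "foldr (\<lambda>(g, r). word_cons g r) (word_cons g r u) v =
         word_cons g r (foldr (\<lambda>(g, r). word_cons g r) u v)"
proof (cases u)
  case (Cons p w)
  obtain h q where p: "p = (h, q)" by (cases p)
  have "reduced_word S (foldr (\<lambda>(g, r). word_cons g r) w v)"
    using assms by (intro reduced_mult) (auto simp: Cons p reduced_Cons)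
  note wc = word_cons_word_cons[OF this]
  show ?thesis by (auto simp: Cons p wc)
qed auto

lemma mult_assoc_words:
  assumes "reduced_word S u" "reduced_word S v" "reduced_word S w"
  shows "foldr (\<lambda>(g, r). word_cons g r) (foldr (\<lambda>(g, r). word_cons g r) u v) w =
         foldr (\<lambda>(g, r). word_cons g r) u (foldr (\<lambda>(g, r). word_cons g r) v w)"
  using assms(1)
proof (induction u)
  case (Cons p u)
  obtain g r where p: "p = (g, r)" by (cases p)
  have u: "reduced_word S u" using Cons.prems by (auto simp: p reduced_Cons)
  show ?case
    using Cons.IH[OF u] mult_word_cons[OF reduced_mult[OF u assms(2)] assms(3)] by (simp add: p)
qed simp

lemma group_free_product_real: "group (free_product_real S)"
proof (rule groupI)
  fix x assume "x \<in> carrier (free_product_real S)"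
  then have "reduced_word S x" by simp
  then have "\<exists>y. reduced_word S y \<and> foldr (\<lambda>(g, r). word_cons g r) y x = []"
  proof (induction x)
    case (Cons p x)
    obtain g r where p: "p = (g, r)" by (cases p)
    have x: "reduced_word S x" "g \<in> S" "r \<noteq> 0" using Cons.prems by (auto simp: p reduced_Cons)
    obtain y where y: "reduced_word S y" "foldr (\<lambda>(g, r). word_cons g r) y x = []"
      using Cons.IH x by blast
    have l: "reduced_word S (letter g (- r))" by (simp add: reduced_letter x)
    have "foldr (\<lambda>(g, r). word_cons g r) (letter g (- r)) (p # x) = x"
      using x by (simp add: letter_def p)
    then have "foldr (\<lambda>(g, r). word_cons g r)
        (foldr (\<lambda>(g, r). word_cons g r) y (letter g (- r))) (p # x) = []"
      using mult_assoc_words[OF y(1) l Cons.prems] y(2) by simp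
    then show ?case using reduced_mult[OF y(1) l] by blast
  qed (auto intro: exI[of _ "[]"])
  then show "\<exists>y\<in>carrier (free_product_real S). y \<otimes>\<^bsub>free_product_real S\<^esub> x = \<one>\<^bsub>free_product_real S\<^esub>"
    by auto
qed (simp_all add: reduced_mult mult_assoc_words)

lemma letter_add:
  "letter g r \<otimes>\<^bsub>free_product_real S\<^esub> letter g s = letter g (r + s)"
  using word_cons_word_cons[of S "[]" g r s] by (simp add: letter_def)

lemma inv_letter:
  assumes "g \<in> S" shows "inv\<^bsub>free_product_real S\<^esub> letter g r = letter g (- r)"
  by (rule group.inv_equality[OF group_free_product_real])
    (use assms in \<open>simp_all only: letter_add free_product_real_simps reduced_letter,
      simp add: letter_def\<close>)

lemma generate_letters:
  "generate (free_product_real S) {letter g r | g r. g \<in> S} = carrier (free_product_real S)"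
proof
  let ?L = "{letter g r | g r. g \<in> S}"
  show "generate (free_product_real S) ?L \<subseteq> carrier (free_product_real S)"
    by (rule group.generate_incl[OF group_free_product_real]) (auto simp: reduced_letter)
  show "carrier (free_product_real S) \<subseteq> generate (free_product_real S) ?L"
  proof
    fix w assume "w \<in> carrier (free_product_real S)"
    then have "reduced_word S w" by simp
    then show "w \<in> generate (free_product_real S) ?L"
    proof (induction w)
      case Nil
      show ?case using generate.one[of "free_product_real S" ?L] by simp
    next
      case (Cons p w)
      obtain g r where p: "p = (g, r)" by (cases p)
      have w: "reduced_word S w" "g \<in> S" "r \<noteq> 0" using Cons.prems by (auto simp: p reduced_Cons)
      have "letter g r \<in> generate (free_product_real S) ?L"
        using w by (intro generate.incl) auto
      from generate.eng[OF this Cons.IH[OF w(1)]] show ?case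
        using word_cons_reduced[OF Cons.prems[unfolded p]] w(3) by (simp add: letter_def p)
    qed
  qed
qed

text \<open>The universal property, in a form that also covers words with exponents in a set \<open>A\<close> such as
  the integers.\<close>

context
  fixes H (structure) and S :: "'a set" and A :: "real set" and f :: "'a \<Rightarrow> real \<Rightarrow> 'b"
  assumes H: "group H"
    and A0: "0 \<in> A" and A_add: "\<And>r s. r \<in> A \<Longrightarrow> s \<in> A \<Longrightarrow> r + s \<in> A"
    and f_closed: "\<And>g r. g \<in> S \<Longrightarrow> r \<in> A \<Longrightarrow> f g r \<in> carrier H"
    and f_add: "\<And>g r s. g \<in> S \<Longrightarrow> r \<in> A \<Longrightarrow> s \<in> A \<Longrightarrow> f g (r + s) = f g r \<otimes> f g s"
begin

interpretation group H by (rule H)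

lemma lift_f0: "g \<in> S \<Longrightarrow> f g 0 = \<one>"
  using f_add[of g 0 0] f_closed[of g 0] A0 by (metis add_0 r_cancel_one)

lemma lift_closed: "set w \<subseteq> S \<times> A \<Longrightarrow> lift_map H f w \<in> carrier H"
  by (induction w) (auto simp: lift_map_def f_closed)

lemma lift_word_cons:
  assumes "g \<in> S" "r \<in> A" "set w \<subseteq> S \<times> A"
  shows "lift_map H f (word_cons g r w) = f g r \<otimes> lift_map H f w"
proof (cases w)
  case Nil
  then show ?thesis using assms by (auto simp: lift_map_def lift_f0)
next
  case (Cons p v)
  obtain h q where p: "p = (h, q)" by (cases p)
  have *: "lift_map H f ((h', q') # v') = f h' q' \<otimes> lift_map H f v'" for h' q' v' by (simp add: lift_map_def)
  have v: "lift_map H f v \<in> carrier H" using assms Cons by (intro lift_closed) auto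
  have hq: "h \<in> S" "q \<in> A" using assms Cons p by auto
  have c: "f g r \<in> carrier H" "f h q \<in> carrier H" using assms hq f_closed by auto
  have "f g r \<otimes> (f h q \<otimes> lift_map H f v) = f g (r + q) \<otimes> lift_map H f v" if "g = h"
    using that m_assoc[OF c v] f_add[OF assms(1,2) hq(2)] by simp
  then show ?thesis
    using assms(1) v c by (auto simp: Cons p * lift_f0)
qed

lemma word_cons_exponents:
  "g \<in> S \<Longrightarrow> r \<in> A \<Longrightarrow> set w \<subseteq> S \<times> A \<Longrightarrow> set (word_cons g r w) \<subseteq> S \<times> A"
  by (cases "(g, r, w)" rule: word_cons.cases) (auto simp: A_add)

lemma mult_exponents:
  "set u \<subseteq> S \<times> A \<Longrightarrow> set v \<subseteq> S \<times> A \<Longrightarrow>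
   set (foldr (\<lambda>(g, r). word_cons g r) u v) \<subseteq> S \<times> A"
  by (induction u) (auto dest!: word_cons_exponents[THEN subsetD, rotated -1])

lemma lift_mult:
  assumes "set u \<subseteq> S \<times> A" "set v \<subseteq> S \<times> A"
  shows "lift_map H f (u \<otimes>\<^bsub>free_product_real S\<^esub> v) = lift_map H f u \<otimes> lift_map H f v"
  using assms(1)
proof (induction u)
  case Nil
  then show ?case using lift_closed[OF assms(2)] by (simp add: lift_map_def)
next
  case (Cons p u)
  obtain g r where p: "p = (g, r)" by (cases p)
  have u: "set u \<subseteq> S \<times> A" "g \<in> S" "r \<in> A" using Cons.prems p by auto
  have "lift_map H f (p # u) = f g r \<otimes> lift_map H f u" by (simp add: lift_map_def p)
  then show ?case
    using Cons.IH[OF u(1)] lift_word_cons[OF u(2,3) mult_exponents[OF u(1) assms(2)]]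
      m_assoc[OF f_closed[OF u(2,3)] lift_closed[OF u(1)] lift_closed[OF assms(2)]]
    by (simp add: p)
qed

lemma lift_letter: "g \<in> S \<Longrightarrow> r \<in> A \<Longrightarrow> lift_map H f (letter g r) = f g r"
  using lift_word_cons[of g r "[]"] f_closed[of g r] by (simp add: letter_def lift_map_def)

end

lemma lift_hom:
  fixes f :: "'a \<Rightarrow> real \<Rightarrow> 'b" and H (structure)
  assumes "group H" "\<And>g r. g \<in> S \<Longrightarrow> f g r \<in> carrier H"
    "\<And>g r s. g \<in> S \<Longrightarrow> f g (r + s) = f g r \<otimes> f g s"
  shows "lift_map H f \<in> hom (free_product_real S) H"
proof (rule homI)
  have S: "set w \<subseteq> S \<times> UNIV" if "w \<in> carrier (free_product_real S)" for w
    using that by (auto simp: reduced_word_def)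
  show "lift_map H f x \<in> carrier H" if "x \<in> carrier (free_product_real S)" for x
    by (rule lift_closed[where A = UNIV and S = S]) (use assms S[OF that] in auto)
  show "lift_map H f (x \<otimes>\<^bsub>free_product_real S\<^esub> y) = lift_map H f x \<otimes> lift_map H f y"
    if "x \<in> carrier (free_product_real S)" "y \<in> carrier (free_product_real S)" for x y
    by (rule lift_mult[where A = UNIV]) (use assms S[OF that(1)] S[OF that(2)] in auto)
qed

lemma psi_hom: "psi G t \<in> hom (FR G) (FR G)"
  unfolding psi_def
  by (rule lift_hom[OF group_free_product_real])
    (simp_all only: letter_add free_product_real_simps(1) reduced_letter distrib_left)

lemma psi_letter:
  assumes "g \<in> carrier G" shows "psi G t (letter g r) = letter g (t * r)"
  unfolding psi_def
  by (rule lift_letter[where A = UNIV and S = "carrier G"])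
    (simp_all only: letter_add free_product_real_simps(1) reduced_letter distrib_left assms
      group_free_product_real UNIV_I)

lemma free_grp_simps:
  "carrier (free_grp G) = generate (FR G) ((\<lambda>g. letter g 1) ` carrier G)"
  "(\<otimes>\<^bsub>free_grp G\<^esub>) = (\<otimes>\<^bsub>FR G\<^esub>)" "\<one>\<^bsub>free_grp G\<^esub> = \<one>\<^bsub>FR G\<^esub>"
proof -
  have "carrier (FR G) \<inter> (\<lambda>g. letter g 1) ` carrier G = (\<lambda>g. letter g 1) ` carrier G"
    by (auto simp: reduced_letter)
  then show "carrier (free_grp G) = generate (FR G) ((\<lambda>g. letter g 1) ` carrier G)"
    by (simp add: free_grp_def subgroup_generated_def)
qed (simp_all add: free_grp_def subgroup_generated_def)

lemma group_free_grp: "group (free_grp G)"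
  unfolding free_grp_def by (rule group.group_subgroup_generated[OF group_free_product_real])

lemma word_cons_Ints:
  "g \<in> S \<Longrightarrow> r \<in> \<int> \<Longrightarrow> set w \<subseteq> S \<times> \<int> \<Longrightarrow> set (word_cons g r w) \<subseteq> S \<times> \<int>"
  by (cases "(g, r, w)" rule: word_cons.cases) auto

lemma free_grp_integer_exponents:
  assumes "w \<in> carrier (free_grp G)" shows "set w \<subseteq> carrier G \<times> \<int>"
  using assms unfolding free_grp_simps
proof (induction rule: generate.induct)
  case (eng u v)
  from eng.IH show ?case
  proof (induction u)
    case (Cons p u)
    then show ?case
      using word_cons_Ints[of "fst p" "carrier G" "snd p" "u \<otimes>\<^bsub>FR G\<^esub> v"] by (auto split: prod.splits)
  qed simp
next
  case (inv h)
  then obtain g where g: "g \<in> carrier G" "h = letter g 1" by auto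
  show ?case unfolding g(2) inv_letter[OF g(1)] using g(1) by (auto simp: letter_def)
qed (auto simp: letter_def)

lemma (in group) proj_hom: "proj G \<in> hom (free_grp G) G"
proof (rule homI)
  show "proj G x \<in> carrier G" if "x \<in> carrier (free_grp G)" for x
    unfolding proj_def
    by (rule lift_closed[where A = \<int> and S = "carrier G"])
      (use free_grp_integer_exponents[OF that] in \<open>auto simp: int_pow_mult elim!: Ints_cases\<close>)
  show "proj G (x \<otimes>\<^bsub>free_grp G\<^esub> y) = proj G x \<otimes> proj G y"
    if "x \<in> carrier (free_grp G)" "y \<in> carrier (free_grp G)" for x y
    unfolding proj_def free_grp_simps
    by (rule lift_mult[where A = \<int> and S = "carrier G"])
      (use free_grp_integer_exponents[OF that(1)] free_grp_integer_exponents[OF that(2)] in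
        \<open>auto simp: int_pow_mult elim!: Ints_cases simp flip: of_int_add\<close>)
qed

lemma (in group) proj_letter:
  assumes "g \<in> carrier G" shows "proj G (letter g 1) = g"
  using assms by (simp add: proj_def lift_map_def letter_def int_pow_1)

end

theory Submission
  imports Defs
begin

text \<open>
  Call \<open>t \<mapsto> psi G (1/t) (w t)\<close> the rescaled path of \<open>w\<close>. Two facts drive everything.
  First, all the groups in sight are linked by homomorphisms that carry one pseudonorm
  to the next as an infimum over preimages: \<open>D_group \<rightarrow> C_group \<rightarrow> asym_cone\<close>.
  Such a map (locale \<open>norm_quotient\<close>) passes both completeness and separability from its source to
  its target, so the two parts of the Polish property only have to be checked for \<open>D_group\<close>, whose
  pseudonorm is simply a limit along the scaling set. Second, for a fixed word \<open>x\<close> the map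
  \<open>s \<mapsto> psi G s x\<close> is Lipschitz (lemma \<open>psi_Lipschitz_in_scale\<close>): changing the exponent of a letter
  over \<open>g\<close> by \<open>\<delta>\<close> costs at most \<open>\<bar>\<delta>\<bar> * N g\<close>.

  Completeness of \<open>D_group\<close> (lemma \<open>D_sequence_converges\<close>) is a diagonal argument. If
  \<open>w n\<close> and \<open>w (n+1)\<close> are at distance less than \<open>2^-n\<close> for all \<open>n\<close>, let
  \<open>v t = w (n t) t\<close> where \<open>n t\<close> tends to infinity
  so slowly that at time \<open>t\<close> the consecutive distances up to index \<open>n t\<close> are already below their
  bounds. Then \<open>v\<close> is eventually within \<open>2 * 2^-n\<close> of \<open>w n\<close>, for every \<open>n\<close>, which gives at once that
  \<open>v\<close> is Cauchy after rescaling and that \<open>w n\<close> converges to \<open>v\<close>.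

  Separability of \<open>D_group\<close> for countable \<open>G\<close> (lemma \<open>cone_separable\<close>): the rescaled path of \<open>w\<close>
  stays near one of its own values \<open>psi G (1/t) x\<close>, \<open>x = w t\<close>, hence near \<open>psi G r x\<close> for a rational \<open>r\<close>.
  There are only countably many pairs \<open>(r, x)\<close> because \<open>x\<close> is a word with integer exponents; choosing
  one element of \<open>D_group\<close> close to each \<open>psi G r x\<close> that can be approached at all, for each tolerance
  \<open>1/(n+1)\<close>, gives a countable dense set.

  The contraction on the cone over \<open>(0,\<infinity>)\<close> is change of time: \<open>\<phi> s\<close> is induced by
  \<open>g \<mapsto> (t \<mapsto> g (s * t))\<close>. On \<open>D_group\<close> the same operation replaces the rescaled path of \<open>w\<close> at time
  \<open>t\<close> by \<open>psi G s\<close> applied to the rescaled path at time \<open>s * t\<close>, so it multiplies norms by at most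
  \<open>s\<close>. This makes \<open>\<phi> s\<close> well defined and \<open>s\<close>-Lipschitz, and shows that the trivial homomorphism is
  the right value at \<open>s = 0\<close>. For continuity in \<open>s\<close>, if the rescaled path of \<open>w\<close> is eventually close
  to \<open>x\<close>, then that of its time change is eventually at least as close to \<open>psi G s x\<close> for
  each \<open>s \<in> [0,1]\<close>, and \<open>psi G s x\<close> depends continuously on \<open>s\<close>.
\<close>

section \<open>Pseudonormed groups\<close>

lemma (in group) mult_inv_cancel_left [simp]:
  "x \<in> carrier G \<Longrightarrow> y \<in> carrier G \<Longrightarrow> x \<otimes> (inv x \<otimes> y) = y"
  "x \<in> carrier G \<Longrightarrow> y \<in> carrier G \<Longrightarrow> inv x \<otimes> (x \<otimes> y) = y"
  by (simp_all add: m_assoc[symmetric])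

locale pseudonorm_group = group G for G (structure) +
  fixes N :: "'a \<Rightarrow> real"
  assumes pn_nonneg: "g \<in> carrier G \<Longrightarrow> 0 \<le> N g"
    and pn_one: "N \<one> = 0"
    and pn_inv: "g \<in> carrier G \<Longrightarrow> N (inv g) = N g"
    and pn_mult: "\<lbrakk>g \<in> carrier G; h \<in> carrier G\<rbrakk> \<Longrightarrow> N (g \<otimes> h) \<le> N g + N h"
    and pn_conj: "\<lbrakk>g \<in> carrier G; h \<in> carrier G\<rbrakk> \<Longrightarrow> N (h \<otimes> g \<otimes> inv h) = N g"

sublocale conj_norm_group \<subseteq> pseudonorm_group G N
  by unfold_locales (use norm_nonneg norm_eq_0_iff norm_inv norm_mult_le norm_conj in auto)

context pseudonorm_group
begin

abbreviation d :: "'a \<Rightarrow> 'a \<Rightarrow> real" where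
  "d \<equiv> norm_dist G N"

lemma d_eq: "x \<in> carrier G \<Longrightarrow> y \<in> carrier G \<Longrightarrow> d x y = N (inv x \<otimes> y)"
  by (simp add: norm_dist_def)

lemma d_nonneg: "0 \<le> d x y"
  by (simp add: norm_dist_def pn_nonneg)

lemma d_self: "d x x = 0"
  by (simp add: norm_dist_def pn_one)

lemma d_commute: "d x y = d y x"
proof -
  have "N (inv x \<otimes> y) = N (inv y \<otimes> x)" if "x \<in> carrier G" "y \<in> carrier G"
    using that pn_inv[of "inv x \<otimes> y"] by (simp add: inv_mult_group)
  then show ?thesis by (simp add: norm_dist_def)
qed

lemma d_triangle:
  assumes "x \<in> carrier G" "y \<in> carrier G" "z \<in> carrier G"
  shows "d x z \<le> d x y + d y z"
proof -
  have "inv x \<otimes> z = (inv x \<otimes> y) \<otimes> (inv y \<otimes> z)"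
    using assms by (simp add: m_assoc)
  then show ?thesis
    using assms pn_mult[of "inv x \<otimes> y" "inv y \<otimes> z"] by (simp add: d_eq)
qed

lemma d_one: "x \<in> carrier G \<Longrightarrow> d \<one> x = N x"
  by (simp add: d_eq)

lemma pn_le_d:
  assumes "x \<in> carrier G" "y \<in> carrier G"
  shows "N y \<le> N x + d x y"
  using d_triangle[of \<one> x y] assms by (simp add: d_one)

text \<open>Multiplication is jointly non-expanding. Conjugation invariance enters here: it lets the first
  factor's difference be moved past the second factor at no cost.\<close>

lemma d_mult:
  assumes "x \<in> carrier G" "y \<in> carrier G" "x' \<in> carrier G" "y' \<in> carrier G"
  shows "d (x \<otimes> y) (x' \<otimes> y') \<le> d x x' + d y y'"
proof -
  have "inv (x \<otimes> y) \<otimes> (x' \<otimes> y') = (inv y \<otimes> (inv x \<otimes> x') \<otimes> inv (inv y)) \<otimes> (inv y \<otimes> y')"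
    using assms by (simp add: m_assoc inv_mult_group)
  then show ?thesis
    using assms pn_mult[of "inv y \<otimes> (inv x \<otimes> x') \<otimes> inv (inv y)" "inv y \<otimes> y'"]
      pn_conj[of "inv x \<otimes> x'" "inv y"] by (simp add: d_eq)
qed

lemma d_inv:
  assumes "x \<in> carrier G" "y \<in> carrier G"
  shows "d (inv x) (inv y) = d x y"
proof -
  have "x \<otimes> inv y = x \<otimes> (inv y \<otimes> x) \<otimes> inv x"
    using assms by (simp add: m_assoc)
  then show ?thesis
    using assms pn_conj[of "inv y \<otimes> x" x] d_commute[of x y] by (simp add: d_eq)
qed

lemma d_left_invariant:
  assumes "x \<in> carrier G" "y \<in> carrier G" "z \<in> carrier G"
  shows "d (z \<otimes> x) (z \<otimes> y) = d x y"
  using assms by (simp add: d_eq inv_mult_group m_assoc)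

end

text \<open>For homomorphisms, a bound on norms is a bound on distances.\<close>

lemma pseudonorm_dist_hom_le:
  assumes "pseudonorm_group G N" "pseudonorm_group H M" "f \<in> hom G H"
    and le: "\<And>x. x \<in> carrier G \<Longrightarrow> M (f x) \<le> c * N x"
    and xy: "x \<in> carrier G" "y \<in> carrier G"
  shows "norm_dist H M (f x) (f y) \<le> c * norm_dist G N x y"
proof -
  interpret G: pseudonorm_group G N by fact
  interpret H: pseudonorm_group H M by fact
  interpret group_hom G H f by unfold_locales fact
  show ?thesis
    using xy le[of "inv\<^bsub>G\<^esub> x \<otimes>\<^bsub>G\<^esub> y"] by (simp add: G.d_eq H.d_eq)
qed

context conj_norm_group
begin

lemma metric_space: "Metric_space (carrier G) d"
proof
  show "d x y = 0 \<longleftrightarrow> x = y" if "x \<in> carrier G" "y \<in> carrier G" for x y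
  proof -
    have "inv x \<otimes> y = \<one> \<longleftrightarrow> x = y" 
      using that by (metis inv_closed inv_equality inv_inv l_inv)
    then show ?thesis using that by (simp add: d_eq norm_eq_0_iff)
  qed
qed (use d_nonneg d_commute d_triangle in auto)

sublocale M: Metric_space "carrier G" d
  rewrites "M.mtopology = norm_topology G N"
  by (rule metric_space) (simp add: norm_topology_def)

lemma topspace_norm_topology [simp]: "topspace (norm_topology G N) = carrier G"
  using M.topspace_mtopology .

lemma topological_group: "topological_group_on G (norm_topology G N)"
  unfolding topological_group_on_def
proof (intro conjI)
  show "continuous_map (norm_topology G N) (norm_topology G N) (\<lambda>x. inv x)"
    unfolding M.continuous_map_to_metric
  proof (intro ballI allI impI)
    fix x e assume x: "x \<in> topspace (norm_topology G N)" and e: "(0::real) < e"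
    show "\<exists>U. openin (norm_topology G N) U \<and> x \<in> U \<and> (\<forall>y\<in>U. inv y \<in> M.mball (inv x) e)"
      by (rule exI[of _ "M.mball x e"]) (use x e in \<open>auto simp: d_inv\<close>)
  qed
  show "continuous_map (prod_topology (norm_topology G N) (norm_topology G N)) (norm_topology G N)
      (\<lambda>(x, y). x \<otimes> y)"
    unfolding M.continuous_map_to_metric
  proof (intro ballI allI impI)
    fix p e assume p: "p \<in> topspace (prod_topology (norm_topology G N) (norm_topology G N))"
      and e: "(0::real) < e"
    obtain x y where xy: "p = (x, y)" "x \<in> carrier G" "y \<in> carrier G" using p by auto
    have "d (x \<otimes> y) (x' \<otimes> y') < e"
      if "x' \<in> M.mball x (e/2)" "y' \<in> M.mball y (e/2)" for x' y'
      using d_mult[of x y x' y'] that by auto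
    then show "\<exists>U. openin (prod_topology (norm_topology G N) (norm_topology G N)) U \<and> p \<in> U \<and>
        (\<forall>q\<in>U. (case q of (x, y) \<Rightarrow> x \<otimes> y) \<in> M.mball (case p of (x, y) \<Rightarrow> x \<otimes> y) e)"
      by (intro exI[of _ "M.mball x (e/2) \<times> M.mball y (e/2)"])
        (use xy e in \<open>auto simp: openin_prod_Times_iff\<close>)
  qed
qed (auto simp: is_group)

end

section \<open>Norm-quotients\<close>

text \<open>An element of the target has preimages of almost the same norm, so the target carries the
  infimum of the norm over fibres. This is the one property of the maps
  \<open>D_group \<rightarrow> C_group \<rightarrow> asym_cone\<close> on which completeness and separability of the cone depend.\<close>

locale norm_quotient = D: pseudonorm_group D N + Q: conj_norm_group Q M
  for D :: "('a, 'm) monoid_scheme" and N and Q :: "('b, 'n) monoid_scheme" and M +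
  fixes q :: "'a \<Rightarrow> 'b"
  assumes q_hom: "q \<in> hom D Q"
    and norm_q_le: "w \<in> carrier D \<Longrightarrow> M (q w) \<le> N w"
    and norm_lift: "X \<in> carrier Q \<Longrightarrow> 0 < e \<Longrightarrow> \<exists>w\<in>carrier D. q w = X \<and> N w < M X + e"
begin

sublocale hom: group_hom D Q q
  by unfold_locales (rule q_hom)

lemma dist_q_le: "v \<in> carrier D \<Longrightarrow> w \<in> carrier D \<Longrightarrow> Q.d (q v) (q w) \<le> D.d v w"
  using pseudonorm_dist_hom_le[OF D.pseudonorm_group_axioms Q.pseudonorm_group_axioms q_hom, of 1]
  by (simp add: norm_q_le)

text \<open>By left translation, the starting point of the lift can be prescribed. This is what allows a
  sequence to be lifted term by term.\<close>

lemma dist_lift: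
  assumes "v \<in> carrier D" "X \<in> carrier Q" "Q.d (q v) X < e"
  shows "\<exists>w\<in>carrier D. q w = X \<and> D.d v w < e"
proof -
  let ?Y = "inv\<^bsub>Q\<^esub> q v \<otimes>\<^bsub>Q\<^esub> X"
  obtain u where u: "u \<in> carrier D" "q u = ?Y" "N u < M ?Y + (e - Q.d (q v) X)"
    using norm_lift[of ?Y "e - Q.d (q v) X"] assms by auto
  have "q (v \<otimes>\<^bsub>D\<^esub> u) = X"
    using u assms by (simp add: Q.inv_solve_left' Q.m_assoc[symmetric])
  moreover have "D.d v (v \<otimes>\<^bsub>D\<^esub> u) < e"
    using u assms D.d_left_invariant[of "\<one>\<^bsub>D\<^esub>" u v] by (simp add: D.d_one Q.d_eq)
  ultimately show ?thesis using u assms by blast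
qed

text \<open>A Cauchy sequence in the target has a subsequence with summable consecutive distances;
  \<open>dist_lift\<close> turns it into such a sequence upstairs, whose limit maps to the limit wanted.\<close>

lemma mcomplete_if_lifts_converge:
  assumes conv: "\<And>w. \<lbrakk>\<And>n. w n \<in> carrier D; \<And>n. D.d (w n) (w (Suc n)) < (1/2)^n\<rbrakk> \<Longrightarrow>
    \<exists>v\<in>carrier D. (\<lambda>n. D.d (w n) v) \<longlonglongrightarrow> 0"
  shows "Q.M.mcomplete"
  unfolding Q.M.mcomplete_def
proof (intro allI impI)
  fix X assume X: "Q.M.MCauchy X"
  then have Xc: "X n \<in> carrier Q" for n by (auto simp: Q.M.MCauchy_def)
  have "\<exists>N. \<forall>n n'. N \<le> n \<longrightarrow> N \<le> n' \<longrightarrow> Q.d (X n) (X n') < (1/2)^k" for k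
    using X by (simp add: Q.M.MCauchy_def)
  then obtain K where K: "\<And>k n n'. K k \<le> n \<Longrightarrow> K k \<le> n' \<Longrightarrow> Q.d (X n) (X n') < (1/2)^k"
    by metis
  \<comment> \<open>a strictly increasing choice of indices with \<open>K n \<le> r n\<close>\<close>
  define r where "r = rec_nat (K 0) (\<lambda>n m. max (Suc m) (K (Suc n)))"
  have r_Suc: "r (Suc n) = max (Suc (r n)) (K (Suc n))" for n by (simp add: r_def)
  have r_mono: "strict_mono r" by (rule strict_monoI_Suc) (simp add: r_Suc)
  have r_ge: "K n \<le> r n" for n by (cases n) (simp_all add: r_Suc, simp add: r_def)
  have r_dist: "Q.d (X (r n)) (X (r (Suc n))) < (1/2)^n" for n
    using K[of n "r n" "r (Suc n)"] r_ge[of n] r_Suc[of n] by simp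
  have "\<exists>w. \<forall>n. (w n \<in> carrier D \<and> q (w n) = X (r n)) \<and> D.d (w n) (w (Suc n)) < (1/2)^n"
  proof (rule dependent_nat_choice)
    show "\<exists>w. w \<in> carrier D \<and> q w = X (r 0)"
      using norm_lift[OF Xc, of 1] by auto
    show "\<exists>w'. (w' \<in> carrier D \<and> q w' = X (r (Suc n))) \<and> D.d w w' < (1/2)^n"
      if "w \<in> carrier D \<and> q w = X (r n)" for w n
      using dist_lift[of w "X (r (Suc n))" "(1/2)^n"] that r_dist[of n] Xc by auto
  qed
  then obtain w where w: "\<And>n. w n \<in> carrier D" "\<And>n. q (w n) = X (r n)"
    "\<And>n. D.d (w n) (w (Suc n)) < (1/2)^n" by blast
  obtain v where v: "v \<in> carrier D" "(\<lambda>n. D.d (w n) v) \<longlonglongrightarrow> 0"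
    using conv[OF w(1,3)] by blast
  have "(\<lambda>n. Q.d (X (r n)) (q v)) \<longlonglongrightarrow> 0"
  proof (rule tendsto_sandwich[OF _ _ tendsto_const v(2)])
    show "\<forall>\<^sub>F n in sequentially. Q.d (X (r n)) (q v) \<le> D.d (w n) v"
      using dist_q_le[OF w(1) v(1)] w(2) by simp
  qed (simp add: Q.d_nonneg)
  then have "limitin (norm_topology Q M) (X \<circ> r) (q v) sequentially"
    using Xc v(1) by (simp add: Q.M.limitin_metric_dist_null)
  then show "\<exists>x. limitin (norm_topology Q M) X x sequentially"
    using Q.M.MCauchy_convergent_subsequence[OF X r_mono] by blast
qed

lemma separable_if_dense:
  assumes "countable S" "S \<subseteq> carrier D"
    and dense: "\<And>w e. w \<in> carrier D \<Longrightarrow> 0 < e \<Longrightarrow> \<exists>v\<in>S. D.d w v < e"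
  shows "separable_top (norm_topology Q M)"
  unfolding separable_top_def
proof (intro exI[of _ "q ` S"] conjI)
  show "norm_topology Q M closure_of q ` S = topspace (norm_topology Q M)"
  proof -
    have "\<exists>y\<in>q ` S. y \<in> Q.M.mball X e" if X: "X \<in> carrier Q" and e: "0 < e" for X e
    proof -
      obtain w where w: "w \<in> carrier D" "q w = X" using norm_lift[OF X e] by blast
      obtain v where v: "v \<in> S" "D.d w v < e" using dense[OF w(1) e] by blast
      then have "v \<in> carrier D" using assms by blast
      then have "q v \<in> Q.M.mball X e" using dist_q_le[of w v] w v by auto
      then show ?thesis using v by blast
    qed
    then show ?thesis by (auto simp: Q.M.metric_closure_of)
  qed
qed (use assms in auto)

end
section \<open>Image pseudonorms and the quotient by the null elements\<close>

text \<open>For \<open>proj\<close> acting pointwise from \<open>D_group\<close> onto \<open>C_group\<close> this yields \<open>C_norm\<close>. The first two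
  conclusions characterise the infimum, and the third follows from them by transporting each axiom
  along almost optimal preimages.\<close>

lemma image_pseudonorm:
  assumes "pseudonorm_group D N" "group C" "p \<in> hom D C" "p ` carrier D = carrier C"
    and M_def: "\<And>g. M g = Inf {N w | w. w \<in> carrier D \<and> p w = g}"
  shows image_pseudonorm_le: "\<And>w. w \<in> carrier D \<Longrightarrow> M (p w) \<le> N w"
    and image_pseudonorm_lift:
      "\<And>g e. g \<in> carrier C \<Longrightarrow> 0 < e \<Longrightarrow> \<exists>w\<in>carrier D. p w = g \<and> N w < M g + e"
    and pseudonorm_group_image: "pseudonorm_group C M"
proof -
  interpret D: pseudonorm_group D N by fact
  interpret C: group C by fact
  interpret p: group_hom D C p by unfold_locales fact
  have bdd: "bdd_below {N w | w. w \<in> carrier D \<and> p w = g}" for g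
    by (rule bdd_belowI[of _ 0]) (auto simp: D.pn_nonneg)
  have onto: "\<exists>w. w \<in> carrier D \<and> p w = g" if "g \<in> carrier C" for g
  proof -
    have "g \<in> p ` carrier D" using that assms(4) by simp
    then show ?thesis by (rule imageE) (intro exI conjI, simp_all)
  qed
  have ne: "{N w | w. w \<in> carrier D \<and> p w = g} \<noteq> {}" if "g \<in> carrier C" for g
    using onto[OF that] by blast
  show le: "M (p w) \<le> N w" if "w \<in> carrier D" for w
    unfolding M_def using that by (intro cInf_lower bdd) auto
  show lift: "\<exists>w\<in>carrier D. p w = g \<and> N w < M g + e" if "g \<in> carrier C" "0 < e" for g e
    using cInf_lessD[OF ne[OF that(1)], of "M g + e"] that(2) unfolding M_def by force
  have le': "M (p w) \<le> c" if "w \<in> carrier D" "N w \<le> c" for w c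
    using le[OF that(1)] that(2) by linarith
  have nonneg: "0 \<le> M g" if "g \<in> carrier C" for g
    unfolding M_def by (rule cInf_greatest[OF ne[OF that]]) (auto simp: D.pn_nonneg)
  have inv_le: "M (inv\<^bsub>C\<^esub> g) \<le> M g" if g: "g \<in> carrier C" for g
  proof (rule field_le_epsilon)
    fix e :: real assume "0 < e"
    then obtain w where w: "w \<in> carrier D" "p w = g" "N w < M g + e"
      using lift[OF g] by blast
    then show "M (inv\<^bsub>C\<^esub> g) \<le> M g + e"
      using le'[of "inv\<^bsub>D\<^esub> w" "M g + e"] by (simp add: D.pn_inv)
  qed
  have conj_le: "M (h \<otimes>\<^bsub>C\<^esub> g \<otimes>\<^bsub>C\<^esub> inv\<^bsub>C\<^esub> h) \<le> M g" if g: "g \<in> carrier C" and h: "h \<in> carrier C" for g h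
  proof (rule field_le_epsilon)
    fix e :: real assume "0 < e"
    then obtain w where w: "w \<in> carrier D" "p w = g" "N w < M g + e"
      using lift[OF g] by blast
    obtain k where k: "k \<in> carrier D" "p k = h" using onto[OF h] by blast
    show "M (h \<otimes>\<^bsub>C\<^esub> g \<otimes>\<^bsub>C\<^esub> inv\<^bsub>C\<^esub> h) \<le> M g + e"
      using le'[of "k \<otimes>\<^bsub>D\<^esub> w \<otimes>\<^bsub>D\<^esub> inv\<^bsub>D\<^esub> k" "M g + e"] w k by (simp add: D.pn_conj)
  qed
  show "pseudonorm_group C M"
  proof (unfold_locales)
    show "0 \<le> M g" if "g \<in> carrier C" for g by (rule nonneg[OF that])
    show "M \<one>\<^bsub>C\<^esub> = 0"
      using le[of "\<one>\<^bsub>D\<^esub>"] nonneg[of "\<one>\<^bsub>C\<^esub>"] by (simp add: D.pn_one)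
    show "M (inv\<^bsub>C\<^esub> g) = M g" if "g \<in> carrier C" for g
      using inv_le[OF that] inv_le[of "inv\<^bsub>C\<^esub> g"] that by simp
    show "M (h \<otimes>\<^bsub>C\<^esub> g \<otimes>\<^bsub>C\<^esub> inv\<^bsub>C\<^esub> h) = M g" if g: "g \<in> carrier C" and h: "h \<in> carrier C" for g h
    proof -
      have "inv\<^bsub>C\<^esub> h \<otimes>\<^bsub>C\<^esub> (h \<otimes>\<^bsub>C\<^esub> g \<otimes>\<^bsub>C\<^esub> inv\<^bsub>C\<^esub> h) \<otimes>\<^bsub>C\<^esub> inv\<^bsub>C\<^esub> (inv\<^bsub>C\<^esub> h) = g"
        using g h by (simp add: C.m_assoc)
      then show ?thesis
        using conj_le[OF g h] conj_le[of "h \<otimes>\<^bsub>C\<^esub> g \<otimes>\<^bsub>C\<^esub> inv\<^bsub>C\<^esub> h" "inv\<^bsub>C\<^esub> h"] g h by simp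
    qed
    show "M (g \<otimes>\<^bsub>C\<^esub> h) \<le> M g + M h" if g: "g \<in> carrier C" and h: "h \<in> carrier C" for g h
    proof (rule field_le_epsilon)
      fix e :: real assume "0 < e"
      then have e: "0 < e / 2" by simp
      obtain v where v: "v \<in> carrier D" "p v = g" "N v < M g + e / 2" using lift[OF g e] by blast
      obtain w where w: "w \<in> carrier D" "p w = h" "N w < M h + e / 2" using lift[OF h e] by blast
      show "M (g \<otimes>\<^bsub>C\<^esub> h) \<le> M g + M h + e"
        using le'[of "v \<otimes>\<^bsub>D\<^esub> w" "M g + M h + e"] v w D.pn_mult[of v w] by simp
    qed
  qed
qed

context pseudonorm_group
begin

definition null_elements :: "'a set" where
  "null_elements = {g \<in> carrier G. N g = 0}"

text \<open>The norm takes a single value on each coset of the null elements, by \<open>pn_mult_null\<close> below.\<close>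

definition quotient_norm :: "'a set \<Rightarrow> real" where
  "quotient_norm X = the_elem (N ` X)"

lemma null_normal: "null_elements \<lhd> G"
proof (rule normal_invI)
  show "subgroup null_elements G"
  proof (rule subgroupI)
    show "g \<otimes> h \<in> null_elements" if "g \<in> null_elements" "h \<in> null_elements" for g h
      using that pn_mult[of g h] pn_nonneg[of "g \<otimes> h"] by (simp add: null_elements_def)
  qed (auto simp: null_elements_def pn_one pn_inv)
  show "x \<otimes> h \<otimes> inv x \<in> null_elements" if "x \<in> carrier G" "h \<in> null_elements" for x h
    using that by (simp add: null_elements_def pn_conj)
qed

lemma null_elements_norm: "h \<in> null_elements \<Longrightarrow> N h = 0"
  by (simp add: null_elements_def)

lemma null_elementsI: "h \<in> carrier G \<Longrightarrow> N h = 0 \<Longrightarrow> h \<in> null_elements"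
  by (simp add: null_elements_def)

sublocale null: normal null_elements G
  by (rule null_normal)

lemma pn_mult_null:
  assumes "h \<in> null_elements" "g \<in> carrier G"
  shows "N (h \<otimes> g) = N g"
proof -
  have h: "h \<in> carrier G" "N h = 0" using assms by (simp_all add: null_elements_norm)
  show ?thesis
    using pn_mult[of h g] pn_mult[of "inv h" "h \<otimes> g"] h assms(2) by (simp add: pn_inv)
qed

lemma quotient_norm_coset:
  assumes "g \<in> carrier G"
  shows "quotient_norm (null_elements #> g) = N g"
proof -
  have "N ` (null_elements #> g) = {N g}"
    using assms pn_mult_null null.one_closed by (force simp: r_coset_def)
  then show ?thesis by (simp add: quotient_norm_def)
qed

lemma coset_mem_quotient: "g \<in> carrier G \<Longrightarrow> null_elements #> g \<in> carrier (G Mod null_elements)"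
  by (simp add: carrier_FactGroup)

lemma coset_mult:
  "g \<in> carrier G \<Longrightarrow> h \<in> carrier G \<Longrightarrow>
   (null_elements #> g) \<otimes>\<^bsub>G Mod null_elements\<^esub> (null_elements #> h) = null_elements #> (g \<otimes> h)"
  by (simp add: null.rcos_sum)

lemma coset_inv:
  "g \<in> carrier G \<Longrightarrow> inv\<^bsub>G Mod null_elements\<^esub> (null_elements #> g) = null_elements #> (inv g)"
  by (simp add: null.inv_FactGroup null.rcos_inv coset_mem_quotient)

lemma coset_eq_null_iff: "g \<in> carrier G \<Longrightarrow> null_elements #> g = null_elements \<longleftrightarrow> N g = 0"
  using coset_join1[of null_elements g] coset_join2[of g null_elements] null.subgroup_axioms
    null_elementsI null_elements_norm by blast

lemma conj_norm_group_quotient: "conj_norm_group (G Mod null_elements) quotient_norm"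
proof -
  interpret Q: group "G Mod null_elements" by (rule null.factorgroup_is_group)
  have rep: "\<exists>g\<in>carrier G. X = null_elements #> g" if "X \<in> carrier (G Mod null_elements)" for X
    using that by (auto simp: carrier_FactGroup)
  note [simp] = quotient_norm_coset coset_mult coset_inv
  note [simp del] = mult_FactGroup
  show ?thesis
  proof unfold_locales
    show "0 \<le> quotient_norm X" if "X \<in> carrier (G Mod null_elements)" for X
      using rep[OF that] by (auto simp: pn_nonneg)
    show "quotient_norm X = 0 \<longleftrightarrow> X = \<one>\<^bsub>G Mod null_elements\<^esub>"
      if "X \<in> carrier (G Mod null_elements)" for X
      using rep[OF that] coset_eq_null_iff quotient_norm_coset by (metis one_FactGroup)
    show "quotient_norm (inv\<^bsub>G Mod null_elements\<^esub> X) = quotient_norm X"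
      if "X \<in> carrier (G Mod null_elements)" for X
      using rep[OF that] by (auto simp: pn_inv)
    show "quotient_norm (X \<otimes>\<^bsub>G Mod null_elements\<^esub> Y) \<le> quotient_norm X + quotient_norm Y"
      if "X \<in> carrier (G Mod null_elements)" "Y \<in> carrier (G Mod null_elements)" for X Y
      using rep[OF that(1)] rep[OF that(2)] by (auto simp: pn_mult)
    show "quotient_norm (Y \<otimes>\<^bsub>G Mod null_elements\<^esub> X \<otimes>\<^bsub>G Mod null_elements\<^esub>
        inv\<^bsub>G Mod null_elements\<^esub> Y) = quotient_norm X"
      if "X \<in> carrier (G Mod null_elements)" "Y \<in> carrier (G Mod null_elements)" for X Y
      using rep[OF that(1)] rep[OF that(2)] by (auto simp: pn_conj)
  qed
qed

text \<open>A Lipschitz endomorphism maps null elements to null elements, so the choice of representative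
  does not affect the coset.\<close>

lemma induced_hom:
  assumes "f \<in> hom G G" and le: "\<And>g. g \<in> carrier G \<Longrightarrow> N (f g) \<le> c * N g"
  defines "F \<equiv> \<lambda>X. null_elements #> f (SOME g. g \<in> X)"
  shows induced_hom_coset: "\<And>g. g \<in> carrier G \<Longrightarrow> F (null_elements #> g) = null_elements #> f g"
    and induced_hom_in_hom: "F \<in> hom (G Mod null_elements) (G Mod null_elements)"
    and induced_hom_norm_le:
      "\<And>X. X \<in> carrier (G Mod null_elements) \<Longrightarrow> quotient_norm (F X) \<le> c * quotient_norm X"
proof -
  interpret f: group_hom G G f by unfold_locales fact
  show coset: "F (null_elements #> g) = null_elements #> f g" if g: "g \<in> carrier G" for g
  proof -
    have "(SOME h. h \<in> null_elements #> g) \<in> null_elements #> g"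
      by (rule someI[of _ g]) (rule rcos_self[OF g null.subgroup_axioms])
    then obtain k where k: "k \<in> null_elements" "(SOME h. h \<in> null_elements #> g) = k \<otimes> g"
      by (auto simp: r_coset_def)
    have kc: "k \<in> carrier G" and k0: "N k = 0" using k by (simp_all add: null_elements_norm)
    have "f k \<in> null_elements"
      using le[OF kc] pn_nonneg[of "f k"] kc k0 by (intro null_elementsI) simp_all
    then have "null_elements #> (f k \<otimes> f g) = null_elements #> f g"
      using g kc by (metis coset_mult_assoc f.hom_closed null.rcos_const null.subset is_group)
    then show ?thesis
      using k g kc by (simp add: F_def)
  qed
  show "F \<in> hom (G Mod null_elements) (G Mod null_elements)"
    by (rule homI) (auto simp: carrier_FactGroup coset coset_mult simp del: mult_FactGroup)
  show "quotient_norm (F X) \<le> c * quotient_norm X" if "X \<in> carrier (G Mod null_elements)" for X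
    using that by (auto simp: carrier_FactGroup coset quotient_norm_coset le)
qed

end

lemma norm_quotient_null_elements:
  assumes D: "pseudonorm_group D N" and C: "pseudonorm_group C M" and p: "p \<in> hom D C"
    and le: "\<And>w. w \<in> carrier D \<Longrightarrow> M (p w) \<le> N w"
    and lift: "\<And>g e. g \<in> carrier C \<Longrightarrow> 0 < e \<Longrightarrow> \<exists>w\<in>carrier D. p w = g \<and> N w < M g + e"
  shows "norm_quotient D N (C Mod pseudonorm_group.null_elements C M)
    (pseudonorm_group.quotient_norm M) (\<lambda>w. pseudonorm_group.null_elements C M #>\<^bsub>C\<^esub> p w)"
proof -
  interpret D: pseudonorm_group D N by fact
  interpret C: pseudonorm_group C M by fact
  interpret p: group_hom D C p by unfold_locales fact
  show ?thesis
  proof (intro norm_quotient.intro norm_quotient_axioms.intro)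
    show "(\<lambda>w. C.null_elements #>\<^bsub>C\<^esub> p w) \<in> hom D (C Mod C.null_elements)"
      by (rule homI) (simp_all add: C.coset_mem_quotient C.coset_mult del: mult_FactGroup)
    show "C.quotient_norm (C.null_elements #>\<^bsub>C\<^esub> p w) \<le> N w" if "w \<in> carrier D" for w
      using that le by (simp add: C.quotient_norm_coset)
    show "\<exists>w\<in>carrier D. C.null_elements #>\<^bsub>C\<^esub> p w = X \<and> N w < C.quotient_norm X + e"
      if "X \<in> carrier (C Mod C.null_elements)" "0 < e" for X e
      using that lift by (fastforce simp: carrier_FactGroup C.quotient_norm_coset)
  qed (fact D C.conj_norm_group_quotient)+
qed

section \<open>The pseudonorm on the free product\<close>

text \<open>From here on the free product is treated as an abstract group generated by its letters.\<close>

declare free_product_real_simps [simp del]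

interpretation FP: group "free_product_real S" for S
  by (rule group_free_product_real)

lemma letter_closed [simp]: "g \<in> S \<Longrightarrow> letter g r \<in> carrier (free_product_real S)"
  by (simp add: free_product_real_simps reduced_letter)

lemma free_product_induct [consumes 1, case_names one mult]:
  assumes x: "x \<in> carrier (free_product_real S)"
    and one: "P \<one>\<^bsub>free_product_real S\<^esub>"
    and mult: "\<And>g r y. \<lbrakk>g \<in> S; y \<in> carrier (free_product_real S); P y\<rbrakk> \<Longrightarrow>
      P (letter g r \<otimes>\<^bsub>free_product_real S\<^esub> y)"
  shows "P x"
proof -
  have "reduced_word S x" using x by (simp add: free_product_real_simps)
  then show ?thesis
  proof (induction x)
    case Nil
    show ?case using one by (simp add: free_product_real_simps)
  next
    case (Cons a y)
    obtain g r where a: "a = (g, r)" by (cases a)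
    have y: "reduced_word S y" "g \<in> S" "r \<noteq> 0" using Cons.prems by (auto simp: a reduced_Cons)
    have "a # y = letter g r \<otimes>\<^bsub>free_product_real S\<^esub> y"
      using word_cons_reduced[OF Cons.prems[unfolded a]] y
      by (simp add: a letter_def free_product_real_simps)
    then show ?case using mult[of g y r] y Cons.IH by (simp add: free_product_real_simps)
  qed
qed

text \<open>\<open>FR_cost G N x c\<close> means that \<open>c\<close> is the cost of some expression of \<open>x\<close> as a product of conjugates
  of letters, so \<open>FR_norm\<close> is the infimum of the costs. The signs \<open>\<plusminus>1\<close> are absorbed in \<open>r\<close>. As
  an inductive predicate it gives each property of the norm by induction on the expression.\<close>

inductive FR_cost :: "('a, 'm) monoid_scheme \<Rightarrow> ('a \<Rightarrow> real) \<Rightarrow> 'a word \<Rightarrow> real \<Rightarrow> bool"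
  for G :: "('a, 'm) monoid_scheme" and N :: "'a \<Rightarrow> real" where
  FR_cost_one: "FR_cost G N \<one>\<^bsub>FR G\<^esub> 0"
| FR_cost_step: "\<lbrakk>h \<in> carrier (FR G); g \<in> carrier G; FR_cost G N x c\<rbrakk> \<Longrightarrow>
    FR_cost G N (h \<otimes>\<^bsub>FR G\<^esub> letter g r \<otimes>\<^bsub>FR G\<^esub> inv\<^bsub>FR G\<^esub> h \<otimes>\<^bsub>FR G\<^esub> x) (\<bar>r\<bar> * N g + c)"

lemma FR_norm_eq_Inf_cost: "FR_norm G N x = Inf {c. FR_cost G N x c}"
proof -
  let ?F = "\<lambda>(h, g, r, e). h \<otimes>\<^bsub>FR G\<^esub> (letter g r [^]\<^bsub>FR G\<^esub> (e::int)) \<otimes>\<^bsub>FR G\<^esub> inv\<^bsub>FR G\<^esub> h"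
  let ?ok = "\<lambda>(h, g, r::real, e). h \<in> carrier (FR G) \<and> g \<in> carrier G \<and> e \<in> {1, -1 :: int}"
  let ?prod = "\<lambda>ps. foldr (\<otimes>\<^bsub>FR G\<^esub>) (map ?F ps) \<one>\<^bsub>FR G\<^esub>"
  let ?cost = "\<lambda>ps. \<Sum>(h, g, r, e)\<leftarrow>ps. \<bar>r\<bar> * N g"
  have sound: "FR_cost G N (?prod ps) (?cost ps)" if "\<forall>p\<in>set ps. ?ok p" for ps
    using that
  proof (induction ps)
    case Nil
    show ?case using FR_cost_one by simp
  next
    case (Cons p ps)
    obtain h g r e where p: "p = (h, g, r, e)" by (cases p)
    have h: "h \<in> carrier (FR G)" "g \<in> carrier G" "e = 1 \<or> e = -1" using Cons.prems p by auto
    have "letter g r [^]\<^bsub>FR G\<^esub> e = letter g (of_int e * r)"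
      using h(3) h(2) FP.int_pow_neg[of "letter g r" "carrier G" 1] by (auto simp: inv_letter)
    moreover have "\<bar>of_int e * r\<bar> = \<bar>r\<bar>" using h(3) by auto
    ultimately show ?case
      using FR_cost_step[OF h(1,2) Cons.IH, of "of_int e * r"] Cons.prems by (simp add: p)
  qed
  have complete: "\<exists>ps. (\<forall>p\<in>set ps. ?ok p) \<and> y = ?prod ps \<and> c = ?cost ps"
    if "FR_cost G N y c" for y c
    using that
  proof induction
    case FR_cost_one
    show ?case by (rule exI[of _ "[]"]) simp
  next
    case (FR_cost_step h g y c r)
    then obtain ps where "\<forall>p\<in>set ps. ?ok p" "y = ?prod ps" "c = ?cost ps" by blast
    then show ?case
      using FR_cost_step.hyps by (intro exI[of _ "(h, g, r, 1) # ps"]) auto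
  qed
  have "{c. FR_cost G N x c} = {?cost ps | ps. (\<forall>p\<in>set ps. ?ok p) \<and> x = ?prod ps}"
    using sound complete by blast
  then show ?thesis by (simp add: FR_norm_def)
qed

context conj_norm_group
begin

lemma FR_cost_carrier: "FR_cost G N x c \<Longrightarrow> x \<in> carrier (FR G)"
  by (induction rule: FR_cost.induct) auto

lemma FR_cost_nonneg: "FR_cost G N x c \<Longrightarrow> 0 \<le> c"
  by (induction rule: FR_cost.induct) (auto simp: norm_nonneg)

lemma FR_cost_mult:
  "FR_cost G N x a \<Longrightarrow> FR_cost G N y b \<Longrightarrow> FR_cost G N (x \<otimes>\<^bsub>FR G\<^esub> y) (a + b)"
proof (induction rule: FR_cost.induct)
  case FR_cost_one
  then show ?case by (simp add: FR_cost_carrier)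
next
  case (FR_cost_step h g x c r)
  then show ?case
    using FR_cost.FR_cost_step[OF FR_cost_step.hyps(1,2) FR_cost_step.IH[OF FR_cost_step.prems], of r]
    by (simp add: FP.m_assoc FR_cost_carrier add.assoc)
qed

lemma FR_cost_conj_letter:
  assumes "h \<in> carrier (FR G)" "g \<in> carrier G"
  shows "FR_cost G N (h \<otimes>\<^bsub>FR G\<^esub> letter g r \<otimes>\<^bsub>FR G\<^esub> inv\<^bsub>FR G\<^esub> h) (\<bar>r\<bar> * N g)"
  using FR_cost_step[OF assms FR_cost_one, of N r] assms by simp

lemma FR_cost_letter: "g \<in> carrier G \<Longrightarrow> FR_cost G N (letter g r) (\<bar>r\<bar> * N g)"
  using FR_cost_conj_letter[of "\<one>\<^bsub>FR G\<^esub>" g r] by simp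

lemma FR_cost_inv: "FR_cost G N x c \<Longrightarrow> FR_cost G N (inv\<^bsub>FR G\<^esub> x) c"
proof (induction rule: FR_cost.induct)
  case FR_cost_one
  then show ?case by (simp add: FR_cost.FR_cost_one)
next
  case (FR_cost_step h g x c r)
  then show ?case
    using FR_cost_mult[OF FR_cost_step.IH FR_cost_conj_letter[OF FR_cost_step.hyps(1,2), of "- r"]]
    by (simp add: FP.m_assoc FR_cost_carrier FP.inv_mult_group inv_letter add.commute)
qed

lemma FR_cost_conj:
  "FR_cost G N x c \<Longrightarrow> k \<in> carrier (FR G) \<Longrightarrow>
   FR_cost G N (k \<otimes>\<^bsub>FR G\<^esub> x \<otimes>\<^bsub>FR G\<^esub> inv\<^bsub>FR G\<^esub> k) c"
proof (induction rule: FR_cost.induct)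
  case FR_cost_one
  then show ?case by (simp add: FR_cost.FR_cost_one)
next
  case (FR_cost_step h g x c r)
  then show ?case
    using FR_cost.FR_cost_step[of "k \<otimes>\<^bsub>FR G\<^esub> h" G g N _ c r, OF _ _ FR_cost_step.IH]
    by (simp add: FP.m_assoc FR_cost_carrier FP.inv_mult_group)
qed

lemma FR_cost_psi: "FR_cost G N x c \<Longrightarrow> FR_cost G N (psi G t x) (\<bar>t\<bar> * c)"
proof (induction rule: FR_cost.induct)
  case FR_cost_one
  interpret psi: group_hom "FR G" "FR G" "psi G t" by unfold_locales (rule psi_hom)
  show ?case by (simp add: FR_cost.FR_cost_one)
next
  case (FR_cost_step h g x c r)
  interpret psi: group_hom "FR G" "FR G" "psi G t" by unfold_locales (rule psi_hom)
  show ?case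
    using FR_cost.FR_cost_step[of "psi G t h" G g N _ _ "t * r", OF _ _ FR_cost_step.IH]
      FR_cost_step.hyps
    by (simp add: FR_cost_carrier psi_letter algebra_simps abs_mult)
qed

lemma FR_cost_exists: "x \<in> carrier (FR G) \<Longrightarrow> \<exists>c. FR_cost G N x c"
proof (induction rule: free_product_induct)
  case one
  show ?case using FR_cost_one by blast
next
  case (mult g r y)
  then show ?case using FR_cost_mult[OF FR_cost_letter] by blast
qed

lemma FR_norm_le: "FR_cost G N x c \<Longrightarrow> FR_norm G N x \<le> c"
  unfolding FR_norm_eq_Inf_cost
  by (rule cInf_lower) (auto intro!: bdd_belowI[of _ 0] FR_cost_nonneg)

lemma FR_norm_greatest:
  assumes "x \<in> carrier (FR G)" "\<And>c. FR_cost G N x c \<Longrightarrow> b \<le> c"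
  shows "b \<le> FR_norm G N x"
  unfolding FR_norm_eq_Inf_cost using FR_cost_exists[OF assms(1)] assms(2)
  by (intro cInf_greatest) auto

lemma FR_norm_mono:
  assumes "x \<in> carrier (FR G)" "\<And>c. FR_cost G N x c \<Longrightarrow> FR_cost G N y c"
  shows "FR_norm G N y \<le> FR_norm G N x"
  using assms by (intro FR_norm_greatest FR_norm_le) auto

sublocale FR: pseudonorm_group "FR G" "FR_norm G N"
proof unfold_locales
  show nonneg: "0 \<le> FR_norm G N x" if "x \<in> carrier (FR G)" for x
    using that by (intro FR_norm_greatest FR_cost_nonneg)
  show "FR_norm G N \<one>\<^bsub>FR G\<^esub> = 0"
    using FR_norm_le[OF FR_cost_one] nonneg[of "\<one>\<^bsub>FR G\<^esub>"] by simp
  show "FR_norm G N (inv\<^bsub>FR G\<^esub> x) = FR_norm G N x" if "x \<in> carrier (FR G)" for x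
    using that FR_cost_inv[of "inv\<^bsub>FR G\<^esub> x"] by (intro antisym FR_norm_mono FR_cost_inv) auto
  show "FR_norm G N (k \<otimes>\<^bsub>FR G\<^esub> x \<otimes>\<^bsub>FR G\<^esub> inv\<^bsub>FR G\<^esub> k) = FR_norm G N x"
    if "x \<in> carrier (FR G)" "k \<in> carrier (FR G)" for x k
  proof (intro antisym FR_norm_mono FR_cost_conj)
    fix c assume "FR_cost G N (k \<otimes>\<^bsub>FR G\<^esub> x \<otimes>\<^bsub>FR G\<^esub> inv\<^bsub>FR G\<^esub> k) c"
    then show "FR_cost G N x c"
      using FR_cost_conj[of _ c "inv\<^bsub>FR G\<^esub> k"] that by (fastforce simp: FP.m_assoc)
  qed (use that in auto)
  show "FR_norm G N (x \<otimes>\<^bsub>FR G\<^esub> y) \<le> FR_norm G N x + FR_norm G N y"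
    if x: "x \<in> carrier (FR G)" and y: "y \<in> carrier (FR G)" for x y
  proof -
    have "FR_norm G N (x \<otimes>\<^bsub>FR G\<^esub> y) - a \<le> FR_norm G N y" if "FR_cost G N x a" for a
      by (rule FR_norm_greatest[OF y]) (use FR_norm_le[OF FR_cost_mult[OF that]] in force)
    then have "FR_norm G N (x \<otimes>\<^bsub>FR G\<^esub> y) - FR_norm G N y \<le> FR_norm G N x"
      by (intro FR_norm_greatest[OF x]) force
    then show ?thesis by simp
  qed
qed

lemma psi_closed [simp]: "x \<in> carrier (FR G) \<Longrightarrow> psi G t x \<in> carrier (FR G)"
  using psi_hom[of G t] by (auto simp: hom_def)

lemma FR_norm_psi_le:
  assumes x: "x \<in> carrier (FR G)"
  shows "FR_norm G N (psi G t x) \<le> \<bar>t\<bar> * FR_norm G N x"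
proof (cases "t = 0")
  case True
  obtain c where "FR_cost G N x c" using FR_cost_exists[OF x] by blast
  then show ?thesis using FR_norm_le[OF FR_cost_psi[of x c t]] True by simp
next
  case False
  have "FR_norm G N (psi G t x) / \<bar>t\<bar> \<le> FR_norm G N x"
    by (rule FR_norm_greatest[OF x])
      (use False FR_norm_le[OF FR_cost_psi] in \<open>simp add: field_simps\<close>)
  then show ?thesis using False by (simp add: field_simps)
qed

lemma d_psi_le:
  assumes "x \<in> carrier (FR G)" "y \<in> carrier (FR G)"
  shows "FR.d (psi G t x) (psi G t y) \<le> \<bar>t\<bar> * FR.d x y"
  using pseudonorm_dist_hom_le[OF FR.pseudonorm_group_axioms FR.pseudonorm_group_axioms psi_hom
      FR_norm_psi_le assms] .

lemma psi_psi:
  assumes "x \<in> carrier (FR G)"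
  shows "psi G s (psi G t x) = psi G (s * t) x"
proof -
  interpret ps: group_hom "FR G" "FR G" "psi G u" for u by unfold_locales (rule psi_hom)
  from assms show ?thesis
    by (induction rule: free_product_induct) (simp_all add: psi_letter mult.assoc)
qed

text \<open>The word is fixed and the scale varies. The constant is the total cost of the letters of \<open>x\<close>,
  but any constant depending only on \<open>x\<close> serves both applications: density of rational scales, and
  continuity of the contraction.\<close>

lemma psi_Lipschitz_in_scale:
  assumes "x \<in> carrier (FR G)"
  shows "\<exists>K\<ge>0. \<forall>s t. FR.d (psi G s x) (psi G t x) \<le> K * \<bar>s - t\<bar>"
proof -
  interpret ps: group_hom "FR G" "FR G" "psi G u" for u by unfold_locales (rule psi_hom)
  from assms show ?thesis
  proof (induction rule: free_product_induct)
    case one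
    show ?case by (rule exI[of _ 0]) (simp add: FR.d_self)
  next
    case (mult g r y)
    then obtain K where K: "0 \<le> K" "\<And>s t. FR.d (psi G s y) (psi G t y) \<le> K * \<bar>s - t\<bar>" by blast
    have "FR.d (psi G s (letter g r \<otimes>\<^bsub>FR G\<^esub> y)) (psi G t (letter g r \<otimes>\<^bsub>FR G\<^esub> y))
        \<le> (\<bar>r\<bar> * N g + K) * \<bar>s - t\<bar>" for s t
    proof -
      have "FR.d (letter g (s * r)) (letter g (t * r)) = FR_norm G N (letter g (- (s * r) + t * r))"
        using mult(1) by (simp add: FR.d_eq inv_letter letter_add)
      also have "\<dots> \<le> \<bar>- (s * r) + t * r\<bar> * N g"
        by (rule FR_norm_le[OF FR_cost_letter[OF mult(1)]])
      also have "\<bar>- (s * r) + t * r\<bar> = \<bar>r\<bar> * \<bar>s - t\<bar>"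
        by (simp add: abs_mult[symmetric] algebra_simps abs_minus_commute)
      finally have "FR.d (letter g (s * r)) (letter g (t * r)) \<le> \<bar>r\<bar> * \<bar>s - t\<bar> * N g" .
      then show ?thesis
        using FR.d_mult[of "letter g (s * r)" "psi G s y" "letter g (t * r)" "psi G t y"] mult(1,2)
          K(2)[of s t]
        by (simp add: psi_letter algebra_simps)
    qed
    then show ?case using K(1) norm_nonneg[OF mult(1)] by (intro exI[of _ "\<bar>r\<bar> * N g + K"]) auto
  qed
qed

end

section \<open>The directional asymptotic cone as a norm-quotient\<close>

text \<open>Cauchy's criterion, for limits along the scaling set rather than along a sequence.\<close>

lemma tendsto_if_Cauchy_filter:
  fixes f :: "'a \<Rightarrow> real"
  assumes "F \<noteq> bot"
    and "\<And>e. 0 < e \<Longrightarrow> \<exists>P. eventually P F \<and> (\<forall>x y. P x \<and> P y \<longrightarrow> dist (f x) (f y) < e)"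
  shows "\<exists>l. (f \<longlongrightarrow> l) F"
proof -
  have "cauchy_filter (filtermap f F)" using assms(2) by (simp add: cauchy_filter_metric_filtermap)
  then have "\<exists>l. filtermap f F \<le> nhds l"
    by (rule cauchy_filter_complete_converges[OF _ complete_UNIV])
      (simp_all add: filtermap_bot_iff assms(1))
  then show ?thesis by (simp add: filterlim_def)
qed

locale asymptotic_cone = conj_norm_group G N for G (structure) and N +
  fixes T :: "real set"
  assumes scaling: "scaling_set T"
begin

abbreviation at_T :: "real filter" where
  "at_T \<equiv> inf at_top (principal T)"

abbreviation scaled :: "(real \<Rightarrow> 'a word) \<Rightarrow> real \<Rightarrow> 'a word" where
  "scaled w t \<equiv> psi G (1 / t) (w t)"

abbreviation proj_path :: "(real \<Rightarrow> 'a word) \<Rightarrow> real \<Rightarrow> 'a" where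
  "proj_path w \<equiv> restrict (proj G \<circ> w) T"

lemma T_pos: "t \<in> T \<Longrightarrow> 0 < t"
  using scaling by (auto simp: scaling_set_def)

lemma T_unbounded: "\<exists>t\<in>T. M \<le> t"
proof (rule ccontr)
  assume "\<not> (\<exists>t\<in>T. M \<le> t)"
  then have "norm t \<le> M" if "t \<in> T" for t using that T_pos[OF that] by force
  then have "bounded T" by (meson boundedI)
  then show False using scaling by (simp add: scaling_set_def)
qed

lemma eventually_at_T: "eventually P at_T \<longleftrightarrow> (\<exists>M. \<forall>t\<in>T. M \<le> t \<longrightarrow> P t)"
  by (auto simp: eventually_inf_principal eventually_at_top_linorder)

lemma eventually_at_TI: "(\<And>t. t \<in> T \<Longrightarrow> P t) \<Longrightarrow> eventually P at_T"
  by (auto simp: eventually_at_T)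

lemma at_T_neq_bot: "at_T \<noteq> bot"
proof
  assume "at_T = bot"
  then have "eventually (\<lambda>_. False) at_T" by simp
  then show False using T_unbounded by (auto simp: eventually_at_T)
qed

lemma free_grp_closed: "x \<in> carrier (free_grp G) \<Longrightarrow> x \<in> carrier (FR G)"
  using FP.generate_incl[of "(\<lambda>g. letter g 1) ` carrier G" "carrier G"]
  by (auto simp: free_grp_simps image_subset_iff)

lemma inv_free_grp: "x \<in> carrier (free_grp G) \<Longrightarrow> inv\<^bsub>free_grp G\<^esub> x = inv\<^bsub>FR G\<^esub> x"
  unfolding free_grp_def by (rule FP.inv_subgroup_generated)

lemma D_carrier_iff:
  "w \<in> carrier (D_group G N T) \<longleftrightarrow>
   w \<in> (\<Pi>\<^sub>E t\<in>T. carrier (free_grp G)) \<and>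
   (\<forall>e>0. \<exists>M. \<forall>t\<in>T. \<forall>t'\<in>T. M \<le> t \<longrightarrow> M \<le> t' \<longrightarrow> FR.d (scaled w t) (scaled w t') < e)"
  by (simp add: D_group_def)

lemma D_closed: "w \<in> carrier (D_group G N T) \<Longrightarrow> t \<in> T \<Longrightarrow> w t \<in> carrier (free_grp G)"
  by (auto simp: D_carrier_iff)

lemma D_closed_FR [simp]: "w \<in> carrier (D_group G N T) \<Longrightarrow> t \<in> T \<Longrightarrow> w t \<in> carrier (FR G)"
  using D_closed free_grp_closed by blast

lemma D_Cauchy:
  assumes "w \<in> carrier (D_group G N T)" "0 < e"
  obtains M where "\<And>t t'. \<lbrakk>t \<in> T; t' \<in> T; M \<le> t; M \<le> t'\<rbrakk> \<Longrightarrow> FR.d (scaled w t) (scaled w t') < e"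
  using assms unfolding D_carrier_iff by blast

lemma D_mult:
  "v \<otimes>\<^bsub>D_group G N T\<^esub> w = (\<lambda>t\<in>T. v t \<otimes>\<^bsub>FR G\<^esub> w t)"
  by (simp add: D_group_def free_grp_simps)

lemma D_one: "\<one>\<^bsub>D_group G N T\<^esub> = (\<lambda>t\<in>T. \<one>\<^bsub>FR G\<^esub>)"
  by (simp add: D_group_def free_grp_simps)

lemma psi_hom_simps:
  "psi G s \<one>\<^bsub>FR G\<^esub> = \<one>\<^bsub>FR G\<^esub>"
  "x \<in> carrier (FR G) \<Longrightarrow> y \<in> carrier (FR G) \<Longrightarrow>
    psi G s (x \<otimes>\<^bsub>FR G\<^esub> y) = psi G s x \<otimes>\<^bsub>FR G\<^esub> psi G s y"
  "x \<in> carrier (FR G) \<Longrightarrow> psi G s (inv\<^bsub>FR G\<^esub> x) = inv\<^bsub>FR G\<^esub> psi G s x"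
proof -
  interpret psi: group_hom "FR G" "FR G" "psi G s" by unfold_locales (rule psi_hom)
  show "psi G s \<one>\<^bsub>FR G\<^esub> = \<one>\<^bsub>FR G\<^esub>"
    "x \<in> carrier (FR G) \<Longrightarrow> y \<in> carrier (FR G) \<Longrightarrow>
      psi G s (x \<otimes>\<^bsub>FR G\<^esub> y) = psi G s x \<otimes>\<^bsub>FR G\<^esub> psi G s y"
    "x \<in> carrier (FR G) \<Longrightarrow> psi G s (inv\<^bsub>FR G\<^esub> x) = inv\<^bsub>FR G\<^esub> psi G s x" by simp_all
qed

abbreviation path_group :: "(real \<Rightarrow> 'a word) monoid" where
  "path_group \<equiv> product_group T (\<lambda>_. free_grp G)"

lemma group_path_group: "group path_group"
  by (simp add: group_free_grp)

lemma D_group_eq: "D_group G N T = path_group\<lparr>carrier := carrier (D_group G N T)\<rparr>"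
  by (simp add: D_group_def)

lemma subgroup_D: "subgroup (carrier (D_group G N T)) path_group"
proof (rule group.subgroupI[OF group_path_group])
  interpret F: group "free_grp G" by (rule group_free_grp)
  show "carrier (D_group G N T) \<subseteq> carrier path_group" by (auto simp: D_group_def)
  have "(\<lambda>t\<in>T. \<one>\<^bsub>free_grp G\<^esub>) \<in> carrier (D_group G N T)"
    using F.one_closed unfolding D_carrier_iff
    by (auto simp: free_grp_simps(3) psi_hom_simps FR.d_self)
  then show "carrier (D_group G N T) \<noteq> {}" by blast
  show "inv\<^bsub>path_group\<^esub> w \<in> carrier (D_group G N T)" if w: "w \<in> carrier (D_group G N T)" for w
  proof -
    have "w \<in> (\<Pi>\<^sub>E t\<in>T. carrier (free_grp G))" using w by (simp add: D_carrier_iff)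
    then have inv: "inv\<^bsub>path_group\<^esub> w = (\<lambda>t\<in>T. inv\<^bsub>free_grp G\<^esub> w t)"
      by (simp add: group_free_grp)
    have "FR.d (scaled (\<lambda>t\<in>T. inv\<^bsub>free_grp G\<^esub> w t) t) (scaled (\<lambda>t\<in>T. inv\<^bsub>free_grp G\<^esub> w t) t') =
        FR.d (scaled w t) (scaled w t')" if "t \<in> T" "t' \<in> T" for t t'
      using that w by (simp add: inv_free_grp D_closed psi_hom_simps FR.d_inv)
    then show ?thesis
      using w unfolding inv by (auto simp: D_carrier_iff)
  qed
  show "v \<otimes>\<^bsub>path_group\<^esub> w \<in> carrier (D_group G N T)"
    if v: "v \<in> carrier (D_group G N T)" and w: "w \<in> carrier (D_group G N T)" for v w
    unfolding D_carrier_iff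
  proof (intro conjI allI impI)
    show "v \<otimes>\<^bsub>path_group\<^esub> w \<in> (\<Pi>\<^sub>E t\<in>T. carrier (free_grp G))"
      using v w by (auto simp: D_closed)
    fix e :: real assume "0 < e"
    then have e: "0 < e / 2" by simp
    obtain M where M: "\<And>t t'. \<lbrakk>t \<in> T; t' \<in> T; M \<le> t; M \<le> t'\<rbrakk> \<Longrightarrow> FR.d (scaled v t) (scaled v t') < e / 2"
      using D_Cauchy[OF v e] by blast
    obtain M' where M': "\<And>t t'. \<lbrakk>t \<in> T; t' \<in> T; M' \<le> t; M' \<le> t'\<rbrakk> \<Longrightarrow> FR.d (scaled w t) (scaled w t') < e / 2"
      using D_Cauchy[OF w e] by blast
    have "FR.d (scaled (v \<otimes>\<^bsub>path_group\<^esub> w) t) (scaled (v \<otimes>\<^bsub>path_group\<^esub> w) t') < e"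
      if "t \<in> T" "t' \<in> T" "max M M' \<le> t" "max M M' \<le> t'" for t t'
      using FR.d_mult[of "scaled v t" "scaled w t" "scaled v t'" "scaled w t'"] M[of t t'] M'[of t t']
        that v w by (simp add: free_grp_simps psi_hom_simps)
    then show "\<exists>M. \<forall>t\<in>T. \<forall>t'\<in>T. M \<le> t \<longrightarrow> M \<le> t' \<longrightarrow>
        FR.d (scaled (v \<otimes>\<^bsub>path_group\<^esub> w) t) (scaled (v \<otimes>\<^bsub>path_group\<^esub> w) t') < e"
      by blast
  qed
qed

lemma group_D: "group (D_group G N T)"
  by (subst D_group_eq) (rule subgroup.subgroup_is_group[OF subgroup_D group_path_group])

lemma D_inv:
  assumes "w \<in> carrier (D_group G N T)"
  shows "inv\<^bsub>D_group G N T\<^esub> w = (\<lambda>t\<in>T. inv\<^bsub>FR G\<^esub> w t)"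
proof -
  have "inv\<^bsub>D_group G N T\<^esub> w = inv\<^bsub>path_group\<^esub> w"
    using group.m_inv_consistent[OF group_path_group subgroup_D assms] D_group_eq by metis
  also have "\<dots> = (\<lambda>t\<in>T. inv\<^bsub>free_grp G\<^esub> w t)"
    using assms by (intro inv_product_group) (auto simp: D_carrier_iff group_free_grp)
  also have "\<dots> = (\<lambda>t\<in>T. inv\<^bsub>FR G\<^esub> w t)"
    using D_closed[OF assms] by (intro restrict_ext inv_free_grp)
  finally show ?thesis .
qed

lemma D_norm_tendsto:
  assumes w: "w \<in> carrier (D_group G N T)"
  shows "((\<lambda>t. FR_norm G N (scaled w t)) \<longlongrightarrow> D_norm G N T w) at_T"
proof -
  have "\<exists>l. ((\<lambda>t. FR_norm G N (scaled w t)) \<longlongrightarrow> l) at_T"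
  proof (rule tendsto_if_Cauchy_filter[OF at_T_neq_bot])
    fix e :: real assume e: "0 < e"
    obtain M where M: "\<And>t t'. \<lbrakk>t \<in> T; t' \<in> T; M \<le> t; M \<le> t'\<rbrakk> \<Longrightarrow> FR.d (scaled w t) (scaled w t') < e"
      using D_Cauchy[OF w e] by blast
    have "dist (FR_norm G N (scaled w t)) (FR_norm G N (scaled w t')) < e"
      if "t \<in> T \<and> M \<le> t" "t' \<in> T \<and> M \<le> t'" for t t'
      using M[of t t'] FR.pn_le_d[of "scaled w t" "scaled w t'"] FR.pn_le_d[of "scaled w t'" "scaled w t"]
        FR.d_commute[of "scaled w t" "scaled w t'"] that w
      by (auto simp: dist_real_def abs_less_iff)
    moreover have "eventually (\<lambda>t. t \<in> T \<and> M \<le> t) at_T"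
      by (auto simp: eventually_at_T)
    ultimately show "\<exists>P. eventually P at_T \<and> (\<forall>t t'. P t \<and> P t' \<longrightarrow>
        dist (FR_norm G N (scaled w t)) (FR_norm G N (scaled w t')) < e)"
      by blast
  qed
  then show ?thesis
    unfolding D_norm_def using tendsto_Lim[OF at_T_neq_bot] by blast
qed

lemma D_norm_le:
  assumes "w \<in> carrier (D_group G N T)" "eventually (\<lambda>t. FR_norm G N (scaled w t) \<le> c) at_T"
  shows "D_norm G N T w \<le> c"
  by (rule tendsto_upperbound[OF D_norm_tendsto[OF assms(1)] assms(2) at_T_neq_bot])

sublocale D: pseudonorm_group "D_group G N T" "D_norm G N T"
proof -
  interpret group "D_group G N T" by (rule group_D)
  note [simp] = D_mult D_inv psi_hom_simps
  \<comment> \<open>\<open>D_norm\<close> depends only on the norms of the rescaled path at times in \<open>T\<close>\<close>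
  have cong: "D_norm G N T v = D_norm G N T w"
    if "v \<in> carrier (D_group G N T)" "w \<in> carrier (D_group G N T)"
      "\<And>t. t \<in> T \<Longrightarrow> FR_norm G N (scaled v t) = FR_norm G N (scaled w t)" for v w
  proof (rule tendsto_unique[OF at_T_neq_bot])
    show "((\<lambda>t. FR_norm G N (scaled w t)) \<longlongrightarrow> D_norm G N T v) at_T"
      by (rule Lim_transform_eventually[OF D_norm_tendsto[OF that(1)]])
        (rule eventually_at_TI, rule that(3))
  qed (rule D_norm_tendsto[OF that(2)])
  show "pseudonorm_group (D_group G N T) (D_norm G N T)"
  proof unfold_locales
    show nonneg: "0 \<le> D_norm G N T w" if "w \<in> carrier (D_group G N T)" for w
      by (rule tendsto_lowerbound[OF D_norm_tendsto[OF that] _ at_T_neq_bot])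
        (rule eventually_at_TI, use that FR.pn_nonneg in simp)
    show "D_norm G N T \<one>\<^bsub>D_group G N T\<^esub> = 0"
    proof (rule antisym)
      show "D_norm G N T \<one>\<^bsub>D_group G N T\<^esub> \<le> 0"
        by (rule D_norm_le[OF one_closed]) (auto intro!: eventually_at_TI simp: D_one FR.pn_one)
    qed (simp add: nonneg)
    show "D_norm G N T (inv\<^bsub>D_group G N T\<^esub> w) = D_norm G N T w"
      if "w \<in> carrier (D_group G N T)" for w
      by (rule cong[OF inv_closed]) (use that FR.pn_inv in simp_all)
    show "D_norm G N T (h \<otimes>\<^bsub>D_group G N T\<^esub> w \<otimes>\<^bsub>D_group G N T\<^esub> inv\<^bsub>D_group G N T\<^esub> h) = D_norm G N T w"
      if wh: "w \<in> carrier (D_group G N T)" "h \<in> carrier (D_group G N T)" for w h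
    proof (rule cong)
      show "h \<otimes>\<^bsub>D_group G N T\<^esub> w \<otimes>\<^bsub>D_group G N T\<^esub> inv\<^bsub>D_group G N T\<^esub> h \<in> carrier (D_group G N T)"
        by (intro m_closed inv_closed wh)
    qed (use wh FR.pn_conj in simp_all)
    show "D_norm G N T (v \<otimes>\<^bsub>D_group G N T\<^esub> w) \<le> D_norm G N T v + D_norm G N T w"
      if vw: "v \<in> carrier (D_group G N T)" "w \<in> carrier (D_group G N T)" for v w
    proof (rule tendsto_le[OF at_T_neq_bot])
      show "((\<lambda>t. FR_norm G N (scaled v t) + FR_norm G N (scaled w t)) \<longlongrightarrow>
          D_norm G N T v + D_norm G N T w) at_T"
        by (intro tendsto_add D_norm_tendsto vw)
      show "((\<lambda>t. FR_norm G N (scaled (v \<otimes>\<^bsub>D_group G N T\<^esub> w) t)) \<longlongrightarrow>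
          D_norm G N T (v \<otimes>\<^bsub>D_group G N T\<^esub> w)) at_T"
        by (intro D_norm_tendsto m_closed vw)
    qed (rule eventually_at_TI, use vw FR.pn_mult in simp)
  qed
qed

lemma D_dist_tendsto:
  assumes v: "v \<in> carrier (D_group G N T)" and w: "w \<in> carrier (D_group G N T)"
  shows "((\<lambda>t. FR.d (scaled v t) (scaled w t)) \<longlongrightarrow> D.d v w) at_T"
proof -
  have "inv\<^bsub>D_group G N T\<^esub> v \<otimes>\<^bsub>D_group G N T\<^esub> w \<in> carrier (D_group G N T)"
    using v w by blast
  from D_norm_tendsto[OF this]
  have "((\<lambda>t. FR_norm G N (scaled (inv\<^bsub>D_group G N T\<^esub> v \<otimes>\<^bsub>D_group G N T\<^esub> w) t)) \<longlongrightarrow> D.d v w) at_T"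
    using v w by (simp add: D.d_eq)
  moreover have "FR_norm G N (scaled (inv\<^bsub>D_group G N T\<^esub> v \<otimes>\<^bsub>D_group G N T\<^esub> w) t) =
      FR.d (scaled v t) (scaled w t)" if "t \<in> T" for t
    using that v w by (simp add: FR.d_eq D_mult D_inv psi_hom_simps)
  ultimately show ?thesis
    by (elim Lim_transform_eventually) (rule eventually_at_TI)
qed

lemma D_dist_le:
  assumes "v \<in> carrier (D_group G N T)" "w \<in> carrier (D_group G N T)"
    "eventually (\<lambda>t. FR.d (scaled v t) (scaled w t) \<le> c) at_T"
  shows "D.d v w \<le> c"
  by (rule tendsto_upperbound[OF D_dist_tendsto[OF assms(1,2)] assms(3) at_T_neq_bot])

lemma proj_path_hom: "proj_path \<in> hom (D_group G N T) (product_group T (\<lambda>_. G))"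
proof (rule homI)
  have cl: "proj G x \<in> carrier G" if "x \<in> carrier (free_grp G)" for x
    using that proj_hom by (auto simp: hom_def)
  show "proj_path w \<in> carrier (product_group T (\<lambda>_. G))" if "w \<in> carrier (D_group G N T)" for w
    using that by (auto simp: D_closed cl)
  have "proj G (x \<otimes>\<^bsub>FR G\<^esub> y) = proj G x \<otimes> proj G y"
    if "x \<in> carrier (free_grp G)" "y \<in> carrier (free_grp G)" for x y
    using that proj_hom by (auto simp: hom_def free_grp_simps(2))
  then show "proj_path (v \<otimes>\<^bsub>D_group G N T\<^esub> w) = proj_path v \<otimes>\<^bsub>product_group T (\<lambda>_. G)\<^esub> proj_path w"
    if "v \<in> carrier (D_group G N T)" "w \<in> carrier (D_group G N T)" for v w
    using that by (auto simp: D_mult D_closed fun_eq_iff)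
qed

lemma C_carrier: "carrier (C_group G N T) = proj_path ` carrier (D_group G N T)"
  by (auto simp: C_group_def)

lemma C_group_eq: "C_group G N T = (product_group T (\<lambda>_. G))\<lparr>carrier := carrier (C_group G N T)\<rparr>"
  by (simp add: C_group_def)

lemma C_mult: "(\<otimes>\<^bsub>C_group G N T\<^esub>) = (\<lambda>x y. \<lambda>t\<in>T. x t \<otimes> y t)"
  by (simp add: C_group_def)

lemma group_C: "group (C_group G N T)"
proof -
  interpret P: group "product_group T (\<lambda>_. G)" by (simp add: is_group)
  interpret group_hom "D_group G N T" "product_group T (\<lambda>_. G)" proj_path
    by unfold_locales (rule proj_path_hom)
  show ?thesis
    by (subst C_group_eq) (simp only: C_carrier subgroup.subgroup_is_group[OF img_is_subgroup P.is_group])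
qed

lemma proj_path_hom_C: "proj_path \<in> hom (D_group G N T) (C_group G N T)"
  using proj_path_hom by (simp add: hom_def C_mult C_carrier)

lemmas C_norm_image =
  image_pseudonorm[OF D.pseudonorm_group_axioms group_C proj_path_hom_C C_carrier[symmetric],
    OF C_norm_def]

sublocale C: pseudonorm_group "C_group G N T" "C_norm G N T"
  by (rule C_norm_image(3))

lemma asym_cone_eq: "asym_cone G N T = C_group G N T Mod C.null_elements"
  unfolding asym_cone_def C.null_elements_def ..

lemma cone_norm_eq: "cone_norm G N T = C.quotient_norm"
  by (intro ext) (simp only: cone_norm_def C.quotient_norm_def)

definition cone_class :: "(real \<Rightarrow> 'a word) \<Rightarrow> (real \<Rightarrow> 'a) set" where
  "cone_class w = C.null_elements #>\<^bsub>C_group G N T\<^esub> proj_path w"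

sublocale cone: norm_quotient "D_group G N T" "D_norm G N T" "asym_cone G N T" "cone_norm G N T" cone_class
  unfolding asym_cone_eq cone_norm_eq cone_class_def[abs_def]
  by (rule norm_quotient_null_elements[OF D.pseudonorm_group_axioms C.pseudonorm_group_axioms
        proj_path_hom_C C_norm_image(1,2)])

text \<open>The diagonal argument. Index \<open>n\<close> becomes active at time \<open>t\<close> once every \<open>w k\<close> with \<open>k \<le> n\<close> has
  settled: from time \<open>t\<close> on its rescaled path varies by less than \<open>(1/2)^k\<close> and stays within
  \<open>(1/2)^k\<close> of that of \<open>w (k+1)\<close>. The limit path follows the largest active index. The condition
  \<open>real n \<le> t\<close> makes the active set finite.\<close>

lemma D_sequence_converges:
  assumes w: "\<And>n. w n \<in> carrier (D_group G N T)"
    and step: "\<And>n. D.d (w n) (w (Suc n)) < (1/2)^n"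
  shows "\<exists>v\<in>carrier (D_group G N T). (\<lambda>n. D.d (w n) v) \<longlonglongrightarrow> 0"
proof -
  have "\<exists>M. (\<forall>t\<in>T. \<forall>t'\<in>T. M \<le> t \<longrightarrow> M \<le> t' \<longrightarrow> FR.d (scaled (w n) t) (scaled (w n) t') < (1/2)^n) \<and>
      (\<forall>t\<in>T. M \<le> t \<longrightarrow> FR.d (scaled (w n) t) (scaled (w (Suc n)) t) < (1/2)^n)" for n
  proof -
    obtain M1 where M1: "\<And>t t'. \<lbrakk>t \<in> T; t' \<in> T; M1 \<le> t; M1 \<le> t'\<rbrakk> \<Longrightarrow>
        FR.d (scaled (w n) t) (scaled (w n) t') < (1/2)^n"
      using D_Cauchy[OF w, of "(1/2)^n" n] by auto
    obtain M2 where M2: "\<And>t. t \<in> T \<Longrightarrow> M2 \<le> t \<Longrightarrow>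
        FR.d (scaled (w n) t) (scaled (w (Suc n)) t) < (1/2)^n"
      using order_tendstoD(2)[OF D_dist_tendsto[OF w w] step[of n]] by (auto simp: eventually_at_T)
    show ?thesis
      by (rule exI[of _ "max M1 M2"]) (use M1 M2 in auto)
  qed
  then obtain M where M: "\<And>n t t'. \<lbrakk>t \<in> T; t' \<in> T; M n \<le> t; M n \<le> t'\<rbrakk> \<Longrightarrow>
        FR.d (scaled (w n) t) (scaled (w n) t') < (1/2)^n"
      "\<And>n t. \<lbrakk>t \<in> T; M n \<le> t\<rbrakk> \<Longrightarrow> FR.d (scaled (w n) t) (scaled (w (Suc n)) t) < (1/2)^n"
    by metis
  define active where "active t = {n. real n \<le> t \<and> (\<forall>k\<le>n. M k \<le> t)}" for t
  \<comment> \<open>\<open>0\<close> is a default for the early times at which no index is active\<close>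
  define idx where "idx t = Max (insert 0 (active t))" for t
  define v where "v = (\<lambda>t\<in>T. w (idx t) t)"
  have fin: "finite (active t)" for t
    by (rule finite_subset[of _ "{..nat \<lceil>t\<rceil>}"]) (auto simp: active_def, linarith)
  have near: "FR.d (scaled (w n) t) (scaled v t) \<le> 2 * (1/2)^n" if t: "t \<in> T" and n: "n \<in> active t" for n t
  proof -
    have n_le: "n \<le> idx t" using fin n by (auto simp: idx_def)
    have "idx t \<in> insert 0 (active t)" unfolding idx_def by (rule Max_in) (simp_all add: fin)
    moreover have "0 \<in> active t" using n by (auto simp: active_def)
    ultimately have idx: "idx t \<in> active t" by auto
    \<comment> \<open>summing the geometric series from \<open>n\<close> to \<open>m - 1\<close>\<close>
    have "FR.d (scaled (w n) t) (scaled (w m) t) \<le> 2 * (1/2)^n - 2 * (1/2)^m" if "n \<le> m" "m \<in> active t" for m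
      using that
    proof (induction m rule: dec_induct)
      case base
      show ?case by (simp add: FR.d_self)
    next
      case (step m)
      have "m \<in> active t" "M m \<le> t" using step.prems by (auto simp: active_def)
      then show ?case
        using FR.d_triangle[of "scaled (w n) t" "scaled (w m) t" "scaled (w (Suc m)) t"]
          step.IH M(2)[OF t, of m] w t by simp
    qed
    from this[OF n_le idx] have "FR.d (scaled (w n) t) (scaled (w (idx t)) t) \<le> 2 * (1/2)^n - 2 * (1/2)^idx t" .
    also have "\<dots> \<le> 2 * (1/2)^n" by simp
    finally show ?thesis using t by (simp add: v_def)
  qed
  have large_active: "\<exists>L. \<forall>t. L \<le> t \<longrightarrow> n \<in> active t" for n
    by (rule exI[of _ "Max (insert (real n) (M ` {..n}))"]) (simp add: active_def)
  have eventually_near: "\<exists>L. \<forall>t\<in>T. L \<le> t \<longrightarrow> FR.d (scaled (w n) t) (scaled v t) \<le> 2 * (1/2)^n" for n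
    using large_active[of n] near by meson
  have v: "v \<in> carrier (D_group G N T)"
    unfolding D_carrier_iff
  proof (intro conjI allI impI)
    show "v \<in> (\<Pi>\<^sub>E t\<in>T. carrier (free_grp G))" using D_closed[OF w] by (auto simp: v_def)
    then have v_cl: "v t \<in> carrier (FR G)" if "t \<in> T" for t using that free_grp_closed by (auto simp: PiE_iff)
    fix e :: real assume "0 < e"
    then obtain n where n: "(1/2)^n < e / 5" using real_arch_pow_inv[of "e / 5" "1/2"] by auto
    obtain L where L: "\<And>t. t \<in> T \<Longrightarrow> L \<le> t \<Longrightarrow> FR.d (scaled (w n) t) (scaled v t) \<le> 2 * (1/2)^n"
      using eventually_near by blast
    have "FR.d (scaled v t) (scaled v t') < e"
      if t: "t \<in> T" "t' \<in> T" "max L (M n) \<le> t" "max L (M n) \<le> t'" for t t'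
    proof -
      have "FR.d (scaled v t) (scaled v t') \<le> FR.d (scaled v t) (scaled (w n) t) +
          (FR.d (scaled (w n) t) (scaled (w n) t') + FR.d (scaled (w n) t') (scaled v t'))"
        using FR.d_triangle[of "scaled v t" "scaled (w n) t" "scaled v t'"]
          FR.d_triangle[of "scaled (w n) t" "scaled (w n) t'" "scaled v t'"] t w v_cl by simp
      also have "\<dots> < e"
        using L[of t] L[of t'] M(1)[of t t' n] t n FR.d_commute[of "scaled v t" "scaled (w n) t"] by simp
      finally show ?thesis .
    qed
    then show "\<exists>L. \<forall>t\<in>T. \<forall>t'\<in>T. L \<le> t \<longrightarrow> L \<le> t' \<longrightarrow> FR.d (scaled v t) (scaled v t') < e"
      by blast
  qed
  have le: "D.d (w n) v \<le> 2 * (1/2)^n" for n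
    by (rule D_dist_le[OF w v]) (use eventually_near in \<open>simp add: eventually_at_T\<close>)
  have "(\<lambda>n. D.d (w n) v) \<longlonglongrightarrow> 0"
  proof (rule tendsto_sandwich[OF _ _ tendsto_const])
    show "(\<lambda>n. 2 * (1/2)^n) \<longlonglongrightarrow> (0::real)"
      using tendsto_mult_right_zero[OF LIMSEQ_power_zero[of "1/2::real"]] by simp
  qed (simp_all add: D.d_nonneg le)
  then show ?thesis using v by blast
qed

lemma cone_mcomplete: "cone.Q.M.mcomplete"
  by (rule cone.mcomplete_if_lifts_converge) (rule D_sequence_converges)

lemma countable_free_grp:
  assumes "countable (carrier G)"
  shows "countable (carrier (free_grp G))"
proof (rule countable_subset)
  show "carrier (free_grp G) \<subseteq> lists (carrier G \<times> \<int>)"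
    using free_grp_integer_exponents by blast
  have "countable (\<int> :: real set)" by (simp add: Ints_def)
  then show "countable (lists (carrier G \<times> (\<int> :: real set)))"
    using assms by (intro countable_lists countable_SIGMA)
qed

text \<open>The dense set is picked from the countably many neighbourhoods of the \<open>psi G r x\<close> that meet
  \<open>D_group\<close>, so no path converging to \<open>psi G r x\<close> has to be constructed.\<close>

lemma cone_separable:
  assumes "countable (carrier G)"
  shows "separable_top (cone_topology G N T)"
proof -
  define close where "close = (\<lambda>(r, x, n) w. w \<in> carrier (D_group G N T) \<and>
    eventually (\<lambda>t. FR.d (scaled w t) (psi G r x) < 1 / real (Suc n)) at_T)"
  define pick where "pick p = (SOME w. close p w)" for p
  define S where "S = pick ` {p \<in> (\<rat> \<times> carrier (free_grp G) \<times> UNIV). \<exists>w. close p w}"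
  have close_pick: "close p (pick p)" if "close p w" for p w
    using someI[of "close p"] that unfolding pick_def by blast
  show ?thesis
  proof (rule cone.separable_if_dense[of S])
    show "countable S"
      unfolding S_def using countable_rat countable_free_grp[OF assms]
      by (intro countable_image countable_Collect countable_SIGMA) auto
    show "S \<subseteq> carrier (D_group G N T)"
      using close_pick by (fastforce simp: S_def close_def)
    fix w e assume w: "w \<in> carrier (D_group G N T)" and e: "(0::real) < e"
    obtain n where n: "2 / real (Suc n) < e"
      using reals_Archimedean[of "e / 2"] e by (auto simp: field_simps)
    \<comment> \<open>half of the tolerance \<open>1/(n+1)\<close>: one half for moving in time, one for making the scale rational\<close>
    let ?h = "1 / real (2 * Suc n)"
    obtain M where M: "\<And>t t'. \<lbrakk>t \<in> T; t' \<in> T; M \<le> t; M \<le> t'\<rbrakk> \<Longrightarrow> FR.d (scaled w t) (scaled w t') < ?h"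
      using D_Cauchy[OF w, of ?h] by auto
    obtain t0 where t0: "t0 \<in> T" "M \<le> t0" using T_unbounded by blast
    obtain K where K: "0 \<le> K" "\<And>s t. FR.d (psi G s (w t0)) (psi G t (w t0)) \<le> K * \<bar>s - t\<bar>"
      using psi_Lipschitz_in_scale[of "w t0"] w t0 by auto
    obtain r :: real where r: "r \<in> \<rat>" "1 / t0 < r" "r < 1 / t0 + ?h / (K + 1)"
      using Rats_dense_in_real[of "1 / t0" "1 / t0 + ?h / (K + 1)"] K(1) by auto
    have "K * \<bar>1 / t0 - r\<bar> \<le> (K + 1) * \<bar>1 / t0 - r\<bar>" by (intro mult_right_mono) auto
    also have "\<dots> < ?h"
    proof -
      have "\<bar>1 / t0 - r\<bar> = r - 1 / t0" using r(2) by simp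
      also have "\<dots> < ?h / (K + 1)" using r(3) by (simp only: diff_less_eq add.commute)
      finally have "\<bar>1 / t0 - r\<bar> < ?h / (K + 1)" .
      then show ?thesis using K(1) by (simp only: pos_less_divide_eq mult.commute[of "K + 1"])
    qed
    finally have near_r: "FR.d (scaled w t0) (psi G r (w t0)) < ?h"
      using K(2)[of "1 / t0" r] by linarith
    have "FR.d (scaled w t) (psi G r (w t0)) < 1 / real (Suc n)" if "t \<in> T" "M \<le> t" for t
    proof -
      have "?h + ?h = 1 / real (Suc n)" by (simp add: field_simps)
      then show ?thesis
        using FR.d_triangle[of "scaled w t" "scaled w t0" "psi G r (w t0)"] M[OF that(1) t0(1) that(2) t0(2)]
          near_r w that t0 by simp
    qed
    then have w_close: "close (r, w t0, n) w"
      using w by (auto simp: close_def eventually_at_T)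
    define v where "v = pick (r, w t0, n)"
    have v_close: "close (r, w t0, n) v" unfolding v_def by (rule close_pick[OF w_close])
    have "v \<in> S" using r(1) D_closed[OF w t0(1)] w_close by (auto simp: S_def v_def)
    moreover have "D.d w v \<le> 2 / real (Suc n)"
    proof (rule D_dist_le[OF w])
      show v: "v \<in> carrier (D_group G N T)" using v_close by (simp add: close_def)
      have "eventually (\<lambda>t. t \<in> T) at_T" by (rule eventually_at_TI)
      then show "eventually (\<lambda>t. FR.d (scaled w t) (scaled v t) \<le> 2 / real (Suc n)) at_T"
      proof (rule eventually_rev_mp)
        have "eventually (\<lambda>t. FR.d (scaled w t) (psi G r (w t0)) < 1 / real (Suc n) \<and>
            FR.d (scaled v t) (psi G r (w t0)) < 1 / real (Suc n)) at_T"
          using w_close v_close by (simp add: close_def eventually_conj_iff)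
        then show "eventually (\<lambda>t. t \<in> T \<longrightarrow> FR.d (scaled w t) (scaled v t) \<le> 2 / real (Suc n)) at_T"
        proof (rule eventually_mono, intro impI)
          fix t assume "FR.d (scaled w t) (psi G r (w t0)) < 1 / real (Suc n) \<and>
            FR.d (scaled v t) (psi G r (w t0)) < 1 / real (Suc n)" and "t \<in> T"
          then show "FR.d (scaled w t) (scaled v t) \<le> 2 / real (Suc n)"
            using FR.d_triangle[of "scaled w t" "psi G r (w t0)" "scaled v t"] w v t0
              FR.d_commute[of "scaled v t" "psi G r (w t0)"] by simp
        qed
      qed
    qed
    ultimately show "\<exists>v\<in>S. D.d w v < e" using n by force
  qed
qed

end

section \<open>The contraction by rescaling\<close>

text \<open>Change of time. At \<open>s = 0\<close> the value \<open>w 0\<close> would lie outside the scaling set; the unit is the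
  continuous extension, since the norm is multiplied by at most \<open>s\<close>.\<close>

definition rescale :: "('b, 'n) monoid_scheme \<Rightarrow> real \<Rightarrow> (real \<Rightarrow> 'b) \<Rightarrow> real \<Rightarrow> 'b" where
  "rescale H s w = (\<lambda>t\<in>{0<..}. if s = 0 then \<one>\<^bsub>H\<^esub> else w (s * t))"

locale full_cone = asymptotic_cone G N "{0<..}" for G (structure) and N
begin

lemma psi_0: "x \<in> carrier (FR G) \<Longrightarrow> psi G 0 x = \<one>\<^bsub>FR G\<^esub>"
  by (induction rule: free_product_induct)
    (simp_all add: psi_hom_simps psi_letter, simp add: letter_def free_product_real_simps)

lemma scaled_rescale_0: "0 < t \<Longrightarrow> scaled (rescale (free_grp G) 0 w) t = \<one>\<^bsub>FR G\<^esub>"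
  by (simp add: rescale_def psi_hom_simps free_grp_simps(3))

text \<open>Changing time by the factor \<open>s\<close> amounts to applying \<open>psi G s\<close> to the rescaled path, up to a
  reparametrisation that does not affect limits.\<close>

lemma scaled_rescale:
  assumes "w \<in> carrier (D_group G N {0<..})" "0 < s" "0 < t"
  shows "scaled (rescale (free_grp G) s w) t = psi G s (scaled w (s * t))"
  using assms by (simp add: rescale_def psi_psi)

lemma eventually_rescale:
  assumes "0 < s" "eventually P at_T"
  shows "eventually (\<lambda>t. P (s * t)) at_T"
proof -
  obtain M where M: "\<And>t. 0 < t \<Longrightarrow> M \<le> t \<Longrightarrow> P t" using assms(2) by (auto simp: eventually_at_T)
  have "P (s * t)" if "0 < t" "M / s \<le> t" for t
    using M[of "s * t"] assms(1) that by (simp add: field_simps)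
  then show ?thesis by (auto simp: eventually_at_T)
qed

lemma rescale_D_closed:
  assumes w: "w \<in> carrier (D_group G N {0<..})" and s: "0 \<le> s"
  shows "rescale (free_grp G) s w \<in> carrier (D_group G N {0<..})"
  unfolding D_carrier_iff
proof (intro conjI allI impI)
  interpret F: group "free_grp G" by (rule group_free_grp)
  show "rescale (free_grp G) s w \<in> (\<Pi>\<^sub>E t\<in>{0<..}. carrier (free_grp G))"
    using D_closed[OF w] s by (auto simp: rescale_def)
  fix e :: real assume e: "0 < e"
  show "\<exists>M. \<forall>t\<in>{0<..}. \<forall>t'\<in>{0<..}. M \<le> t \<longrightarrow> M \<le> t' \<longrightarrow>
      FR.d (scaled (rescale (free_grp G) s w) t) (scaled (rescale (free_grp G) s w) t') < e"
  proof (cases "s = 0")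
    case True
    then show ?thesis using e by (simp add: scaled_rescale_0 FR.d_self)
  next
    case False
    then have s: "0 < s" using s by simp
    obtain M where M: "\<And>t t'. \<lbrakk>t \<in> {0<..}; t' \<in> {0<..}; M \<le> t; M \<le> t'\<rbrakk> \<Longrightarrow> FR.d (scaled w t) (scaled w t') < e / s"
      using D_Cauchy[OF w, of "e / s"] e s by auto
    have "FR.d (scaled (rescale (free_grp G) s w) t) (scaled (rescale (free_grp G) s w) t') < e"
      if t: "0 < t" "0 < t'" "M / s \<le> t" "M / s \<le> t'" for t t'
    proof -
      have "M \<le> s * t" "M \<le> s * t'" using t s by (simp_all add: field_simps)
      then have "FR.d (scaled w (s * t)) (scaled w (s * t')) < e / s"
        using t s by (intro M) auto
      then have "s * FR.d (scaled w (s * t)) (scaled w (s * t')) < e"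
        using s by (simp add: field_simps)
      moreover have "FR.d (psi G s (scaled w (s * t))) (psi G s (scaled w (s * t')))
          \<le> \<bar>s\<bar> * FR.d (scaled w (s * t)) (scaled w (s * t'))"
        using t s w by (intro d_psi_le) auto
      ultimately show ?thesis using t s by (simp add: scaled_rescale[OF w])
    qed
    then show ?thesis by auto
  qed
qed

lemma D_norm_rescale_le:
  assumes w: "w \<in> carrier (D_group G N {0<..})" and s: "0 \<le> s"
  shows "D_norm G N {0<..} (rescale (free_grp G) s w) \<le> s * D_norm G N {0<..} w"
proof (cases "s = 0")
  case True
  show ?thesis
    by (rule D_norm_le[OF rescale_D_closed[OF w s]], rule eventually_at_TI)
      (simp add: True scaled_rescale_0 FR.pn_one)
next
  case False
  then have s: "0 < s" using s by simp
  show ?thesis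
  proof (rule field_le_epsilon)
    fix e :: real assume e: "0 < e"
    have "eventually (\<lambda>t. FR_norm G N (scaled w t) < D_norm G N {0<..} w + e / s) at_T"
      by (rule order_tendstoD(2)[OF D_norm_tendsto[OF w]]) (use e s in simp)
    from eventually_rescale[OF s this]
    have ev: "eventually (\<lambda>t. FR_norm G N (scaled w (s * t)) < D_norm G N {0<..} w + e / s) at_T" .
    have le: "FR_norm G N (scaled (rescale (free_grp G) s w) t) \<le> s * FR_norm G N (scaled w (s * t))"
      if "0 < t" for t
      using FR_norm_psi_le[of "scaled w (s * t)" s] that s w by (simp add: scaled_rescale)
    show "D_norm G N {0<..} (rescale (free_grp G) s w) \<le> s * D_norm G N {0<..} w + e"
    proof (rule D_norm_le[OF rescale_D_closed])
      obtain M where M: "\<And>t. 0 < t \<Longrightarrow> M \<le> t \<Longrightarrow> FR_norm G N (scaled w (s * t)) < D_norm G N {0<..} w + e / s"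
        using ev by (auto simp: eventually_at_T)
      have "FR_norm G N (scaled (rescale (free_grp G) s w) t) \<le> s * D_norm G N {0<..} w + e"
        if t: "0 < t" "M \<le> t" for t
      proof -
        have "s * FR_norm G N (scaled w (s * t)) \<le> s * (D_norm G N {0<..} w + e / s)"
          using M[OF t] s by simp
        also have "\<dots> = s * D_norm G N {0<..} w + e" using s by (simp add: field_simps)
        finally show ?thesis using le[OF t(1)] by linarith
      qed
      then show "eventually (\<lambda>t. FR_norm G N (scaled (rescale (free_grp G) s w) t)
          \<le> s * D_norm G N {0<..} w + e) at_T"
        by (auto simp: eventually_at_T)
    qed (use w s in auto)
  qed
qed

text \<open>With \<open>x\<close> a late value of the rescaled path of \<open>w\<close>, the path of \<open>rescale s w\<close> is eventually within
  \<open>e/3\<close> of \<open>psi G s x\<close> for all \<open>s \<in> [0,1]\<close>. How late depends on \<open>s\<close>, which is harmless because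
  distances in \<open>D_group\<close> are limits.\<close>

lemma rescale_continuous:
  assumes w: "w \<in> carrier (D_group G N {0<..})" and e: "0 < e"
  shows "\<exists>\<delta>>0. \<forall>s\<in>{0..1}. \<forall>s'\<in>{0..1}. \<bar>s - s'\<bar> < \<delta> \<longrightarrow>
    D.d (rescale (free_grp G) s w) (rescale (free_grp G) s' w) \<le> e"
proof -
  obtain M where M: "\<And>t t'. \<lbrakk>t \<in> {0<..}; t' \<in> {0<..}; M \<le> t; M \<le> t'\<rbrakk> \<Longrightarrow> FR.d (scaled w t) (scaled w t') < e / 3"
    using D_Cauchy[OF w, of "e / 3"] e by auto
  obtain m where m: "0 < m" "M \<le> m" using T_unbounded[of M] by auto
  define x where "x = scaled w m"
  have x: "x \<in> carrier (FR G)" using w m by (simp add: x_def)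
  have near: "eventually (\<lambda>t. FR.d (scaled (rescale (free_grp G) s w) t) (psi G s x) \<le> e / 3) at_T"
    if s: "0 \<le> s" "s \<le> 1" for s
  proof (cases "s = 0")
    case True
    show ?thesis
      by (rule eventually_at_TI)
        (use x e in \<open>simp add: True scaled_rescale_0 psi_0 FR.d_self\<close>)
  next
    case False
    then have s0: "0 < s" using s by simp
    have "FR.d (scaled (rescale (free_grp G) s w) t) (psi G s x) \<le> e / 3" if t: "0 < t" "M / s \<le> t" for t
    proof -
      have "M \<le> s * t" using t s0 by (simp add: field_simps)
      then have "FR.d (scaled w (s * t)) x < e / 3"
        using t s0 m unfolding x_def by (intro M) auto
      moreover have "FR.d (psi G s (scaled w (s * t))) (psi G s x) \<le> \<bar>s\<bar> * FR.d (scaled w (s * t)) x"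
        using t s0 w x by (intro d_psi_le) auto
      moreover have "\<bar>s\<bar> * FR.d (scaled w (s * t)) x \<le> 1 * FR.d (scaled w (s * t)) x"
        using s by (intro mult_right_mono) (auto simp: FR.d_nonneg)
      ultimately show ?thesis using t s0 by (simp add: scaled_rescale[OF w])
    qed
    then show ?thesis by (auto simp: eventually_at_T)
  qed
  obtain K where K: "0 \<le> K" "\<And>s t. FR.d (psi G s x) (psi G t x) \<le> K * \<bar>s - t\<bar>"
    using psi_Lipschitz_in_scale[OF x] by blast
  \<comment> \<open>\<open>K + 1\<close> rather than \<open>K\<close> in the denominator, as \<open>K\<close> may be \<open>0\<close>\<close>
  have "D.d (rescale (free_grp G) s w) (rescale (free_grp G) s' w) \<le> e"
    if s: "s \<in> {0..1}" "s' \<in> {0..1}" "\<bar>s - s'\<bar> < e / (3 * (K + 1))" for s s'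
  proof (rule D_dist_le)
    have "K * \<bar>s - s'\<bar> \<le> (K + 1) * \<bar>s - s'\<bar>" by (intro mult_right_mono) auto
    also have "\<dots> \<le> e / 3" using s(3) K(1) by (simp add: field_simps)
    finally have mid: "FR.d (psi G s x) (psi G s' x) \<le> e / 3" using K(2)[of s s'] by linarith
    have cl: "rescale (free_grp G) r w \<in> carrier (D_group G N {0<..})" if "r \<in> {0..1}" for r
      using rescale_D_closed[OF w] that by simp
    then show "rescale (free_grp G) s w \<in> carrier (D_group G N {0<..})"
      "rescale (free_grp G) s' w \<in> carrier (D_group G N {0<..})" using s by auto
    have T: "eventually (\<lambda>t. 0 < t) at_T" by (rule eventually_at_TI) simp
    show "eventually (\<lambda>t. FR.d (scaled (rescale (free_grp G) s w) t)
        (scaled (rescale (free_grp G) s' w) t) \<le> e) at_T"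
    proof (rule eventually_mono)
      show "eventually (\<lambda>t. 0 < t \<and> FR.d (scaled (rescale (free_grp G) s w) t) (psi G s x) \<le> e / 3 \<and>
          FR.d (scaled (rescale (free_grp G) s' w) t) (psi G s' x) \<le> e / 3) at_T"
        using s by (intro eventually_conj T near) auto
      fix t assume t: "0 < t \<and> FR.d (scaled (rescale (free_grp G) s w) t) (psi G s x) \<le> e / 3 \<and>
        FR.d (scaled (rescale (free_grp G) s' w) t) (psi G s' x) \<le> e / 3"
      let ?a = "scaled (rescale (free_grp G) s w) t" and ?b = "scaled (rescale (free_grp G) s' w) t"
      have ab: "?a \<in> carrier (FR G)" "?b \<in> carrier (FR G)" using cl s t by auto
      show "FR.d ?a ?b \<le> e"
        using FR.d_triangle[of ?a "psi G s x" ?b] FR.d_triangle[of "psi G s x" "psi G s' x" ?b]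
          ab x mid t FR.d_commute[of ?b "psi G s' x"] by simp
    qed
  qed
  moreover have "0 < e / (3 * (K + 1))" using e K(1) by simp
  ultimately show ?thesis by blast
qed

lemma proj_path_rescale:
  assumes w: "w \<in> carrier (D_group G N {0<..})" and s: "0 \<le> s"
  shows "proj_path (rescale (free_grp G) s w) = rescale G s (proj_path w)"
proof -
  interpret p: group_hom "free_grp G" G "proj G"
    by (intro group_hom.intro group_hom_axioms.intro group_free_grp is_group proj_hom)
  show ?thesis using s by (auto simp: rescale_def fun_eq_iff)
qed

lemma rescale_C_hom:
  assumes s: "0 \<le> s"
  shows "rescale G s \<in> hom (C_group G N {0<..}) (C_group G N {0<..})"
proof (rule homI)
  show "rescale G s g \<in> carrier (C_group G N {0<..})" if g: "g \<in> carrier (C_group G N {0<..})" for g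
  proof -
    obtain w where w: "w \<in> carrier (D_group G N {0<..})" "g = proj_path w"
      using g unfolding C_carrier by (rule imageE)
    then have "rescale G s g = proj_path (rescale (free_grp G) s w)"
      using proj_path_rescale[OF w(1) s] by simp
    then show ?thesis
      unfolding C_carrier using rescale_D_closed[OF w(1) s] by (rule image_eqI)
  qed
  show "rescale G s (g \<otimes>\<^bsub>C_group G N {0<..}\<^esub> h) =
      rescale G s g \<otimes>\<^bsub>C_group G N {0<..}\<^esub> rescale G s h" for g h
    using s by (auto simp: rescale_def C_mult fun_eq_iff)
qed

lemma C_norm_rescale_le:
  assumes g: "g \<in> carrier (C_group G N {0<..})" and s: "0 \<le> s"
  shows "C_norm G N {0<..} (rescale G s g) \<le> s * C_norm G N {0<..} g"
proof (rule field_le_epsilon)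
  fix e :: real assume e: "0 < e"
  have "0 < e / (s + 1)" using e s by simp
  from C_norm_image(2)[OF g this] obtain w where w: "w \<in> carrier (D_group G N {0<..})" "proj_path w = g"
    "D_norm G N {0<..} w < C_norm G N {0<..} g + e / (s + 1)" by blast
  have "C_norm G N {0<..} (rescale G s g) \<le> s * D_norm G N {0<..} w"
    using C_norm_image(1)[OF rescale_D_closed[OF w(1) s]] D_norm_rescale_le[OF w(1) s]
      proj_path_rescale[OF w(1) s] w(2) by simp
  also have "\<dots> \<le> s * (C_norm G N {0<..} g + e / (s + 1))"
    using w(3) s by (intro mult_left_mono) auto
  also have "\<dots> \<le> s * C_norm G N {0<..} g + e"
    using e s by (simp add: field_simps)
  finally show "C_norm G N {0<..} (rescale G s g) \<le> s * C_norm G N {0<..} g + e" .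
qed

definition cone_scale :: "real \<Rightarrow> (real \<Rightarrow> 'a) set \<Rightarrow> (real \<Rightarrow> 'a) set" where
  "cone_scale s X = C.null_elements #>\<^bsub>C_group G N {0<..}\<^esub> rescale G s (SOME g. g \<in> X)"

lemma cone_scale_hom:
  assumes s: "0 \<le> s"
  shows "cone_scale s \<in> hom (asym_cone G N {0<..}) (asym_cone G N {0<..})"
  using C.induced_hom_in_hom[OF rescale_C_hom[OF s] C_norm_rescale_le[OF _ s]]
  by (simp add: asym_cone_eq cone_scale_def[abs_def])

lemma cone_scale_norm_le:
  assumes "X \<in> carrier (asym_cone G N {0<..})" and s: "0 \<le> s"
  shows "cone_norm G N {0<..} (cone_scale s X) \<le> s * cone_norm G N {0<..} X"
  using C.induced_hom_norm_le[OF rescale_C_hom[OF s] C_norm_rescale_le[OF _ s], of X] assms(1)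
  by (simp add: asym_cone_eq cone_norm_eq cone_scale_def)

lemma cone_scale_lipschitz:
  "0 \<le> s \<Longrightarrow> lipschitz_hom (asym_cone G N {0<..}) (cone_norm G N {0<..})
    (asym_cone G N {0<..}) (cone_norm G N {0<..}) (cone_scale s)"
  using cone_scale_hom cone_scale_norm_le by (auto simp: lipschitz_hom_def)

lemma cone_scale_class:
  assumes w: "w \<in> carrier (D_group G N {0<..})" and s: "0 \<le> s"
  shows "cone_scale s (cone_class w) = cone_class (rescale (free_grp G) s w)"
proof -
  have "proj_path w \<in> carrier (C_group G N {0<..})" using w by (auto simp: C_carrier)
  from C.induced_hom_coset[OF rescale_C_hom C_norm_rescale_le, OF s _ s this]
  show ?thesis by (simp only: cone_scale_def cone_class_def proj_path_rescale[OF w s])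
qed

lemma cone_class_onto: "X \<in> carrier (asym_cone G N {0<..}) \<Longrightarrow> \<exists>w\<in>carrier (D_group G N {0<..}). X = cone_class w"
  using cone.norm_lift[of X 1] by auto

lemma cone_scale_1: "X \<in> carrier (asym_cone G N {0<..}) \<Longrightarrow> cone_scale 1 X = X"
proof -
  assume "X \<in> carrier (asym_cone G N {0<..})"
  then obtain w where w: "w \<in> carrier (D_group G N {0<..})" "X = cone_class w"
    using cone_class_onto by blast
  have "rescale (free_grp G) 1 w = w"
    using w(1) by (auto simp: D_carrier_iff rescale_def fun_eq_iff PiE_iff extensional_def)
  then show ?thesis using w cone_scale_class[of w 1] by simp
qed

lemma cone_scale_0: "X \<in> carrier (asym_cone G N {0<..}) \<Longrightarrow> cone_scale 0 X = \<one>\<^bsub>asym_cone G N {0<..}\<^esub>"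
proof -
  assume "X \<in> carrier (asym_cone G N {0<..})"
  then obtain w where w: "w \<in> carrier (D_group G N {0<..})" "X = cone_class w"
    using cone_class_onto by blast
  have "rescale (free_grp G) 0 w = \<one>\<^bsub>D_group G N {0<..}\<^esub>"
    by (auto simp: D_one rescale_def free_grp_simps(3))
  then show ?thesis using w cone_scale_class[of w 0] by simp
qed

lemma cone_scale_dist_le:
  assumes "X \<in> carrier (asym_cone G N {0<..})" "Y \<in> carrier (asym_cone G N {0<..})" "0 \<le> s"
  shows "cone.Q.d (cone_scale s X) (cone_scale s Y) \<le> s * cone.Q.d X Y"
  by (rule pseudonorm_dist_hom_le[OF cone.Q.pseudonorm_group_axioms cone.Q.pseudonorm_group_axioms
        cone_scale_hom cone_scale_norm_le]) (use assms in auto)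

lemma cone_scale_closed:
  "X \<in> carrier (asym_cone G N {0<..}) \<Longrightarrow> 0 \<le> s \<Longrightarrow> cone_scale s X \<in> carrier (asym_cone G N {0<..})"
  using cone_scale_hom[of s] by (auto simp: hom_def)

text \<open>Joint continuity: each \<open>cone_scale r\<close> with \<open>r \<le> 1\<close> is non-expanding, so only continuity in \<open>s\<close> at a
  fixed point of the cone is needed, and that is \<open>rescale_continuous\<close>.\<close>

lemma cone_scale_continuous:
  "continuous_map (prod_topology (top_of_set {0..1::real}) (cone_topology G N {0<..}))
    (cone_topology G N {0<..}) (\<lambda>(s, X). cone_scale s X)"
  unfolding cone.Q.M.continuous_map_to_metric
proof (intro ballI allI impI)
  fix p and e :: real
  assume p: "p \<in> topspace (prod_topology (top_of_set {0..1::real}) (cone_topology G N {0<..}))" and e: "0 < e"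
  obtain s X where sX: "p = (s, X)" "0 \<le> s" "s \<le> 1" "X \<in> carrier (asym_cone G N {0<..})"
    using p by auto
  obtain w where w: "w \<in> carrier (D_group G N {0<..})" "X = cone_class w"
    using cone_class_onto sX by blast
  obtain \<delta> where \<delta>: "0 < \<delta>" "\<And>s s'. \<lbrakk>s \<in> {0..1}; s' \<in> {0..1}; \<bar>s - s'\<bar> < \<delta>\<rbrakk> \<Longrightarrow>
      D.d (rescale (free_grp G) s w) (rescale (free_grp G) s' w) \<le> e / 2"
    using rescale_continuous[OF w(1), of "e / 2"] e by fastforce
  define U where "U = ({0..1} \<inter> ball s \<delta>) \<times> cone.Q.M.mball X (e / 2)"
  show "\<exists>U. openin (prod_topology (top_of_set {0..1}) (cone_topology G N {0<..})) U \<and> p \<in> U \<and>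
      (\<forall>y\<in>U. (case y of (s, X) \<Rightarrow> cone_scale s X) \<in>
        cone.Q.M.mball (case p of (s, X) \<Rightarrow> cone_scale s X) e)"
  proof (intro exI[of _ U] conjI ballI)
    show "openin (prod_topology (top_of_set {0..1}) (cone_topology G N {0<..})) U"
      unfolding U_def by (simp add: openin_prod_Times_iff openin_open_Int)
    show "p \<in> U" using sX \<delta>(1) e by (simp add: U_def)
    fix y assume "y \<in> U"
    then obtain r Y where rY: "y = (r, Y)" "0 \<le> r" "r \<le> 1" "\<bar>s - r\<bar> < \<delta>"
        "Y \<in> carrier (asym_cone G N {0<..})" "cone.Q.d X Y < e / 2"
      by (auto simp: U_def dist_real_def)
    have "cone.Q.d (cone_scale s X) (cone_scale r X) \<le>
        D.d (rescale (free_grp G) s w) (rescale (free_grp G) r w)"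
      using cone.dist_q_le[OF rescale_D_closed[OF w(1)] rescale_D_closed[OF w(1)]] sX rY
        cone_scale_class[OF w(1)] by (simp add: w(2))
    also have "\<dots> \<le> e / 2" using \<delta>(2)[of s r] sX rY by simp
    finally have 1: "cone.Q.d (cone_scale s X) (cone_scale r X) \<le> e / 2" .
    have "cone.Q.d (cone_scale r X) (cone_scale r Y) \<le> r * cone.Q.d X Y"
      using sX rY by (intro cone_scale_dist_le) auto
    also have "\<dots> \<le> 1 * cone.Q.d X Y"
      using rY by (intro mult_right_mono) (auto simp: cone.Q.d_nonneg)
    finally have 2: "cone.Q.d (cone_scale r X) (cone_scale r Y) < e / 2" using rY by simp
    show "(case y of (s, X) \<Rightarrow> cone_scale s X) \<in>
        cone.Q.M.mball (case p of (s, X) \<Rightarrow> cone_scale s X) e"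
      using 1 2 cone.Q.d_triangle[of "cone_scale s X" "cone_scale r X" "cone_scale r Y"] sX rY
      by (simp add: cone_scale_closed)
  qed
qed

lemma cone_contractible: "contractible_space (cone_topology G N {0<..})"
proof -
  have "homotopic_with (\<lambda>_. True) (cone_topology G N {0<..}) (cone_topology G N {0<..})
      (\<lambda>_. \<one>\<^bsub>asym_cone G N {0<..}\<^esub>) id"
    by (subst homotopic_with)
      (use cone_scale_continuous cone_scale_0 cone_scale_1 in
        \<open>auto intro!: exI[of _ "\<lambda>(s, X). cone_scale s X"]\<close>)
  then show ?thesis
    unfolding contractible_space_def using homotopic_with_symD by blast
qed

end

theorem theorem1p5:
  fixes G :: "('a, 'm) monoid_scheme" and N :: "'a \<Rightarrow> real"
  assumes "conj_norm_group G N"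
  shows "(countable (carrier G) \<longrightarrow>
           (\<forall>T. scaling_set T \<longrightarrow>
              separable_top (cone_topology G N T) \<and>
              polish_group (asym_cone G N T) (cone_topology G N T))) \<and>
         contractible_space (cone_topology G N {0<..}) \<and>
         (\<exists>\<phi> :: real \<Rightarrow> (real \<Rightarrow> 'a) set \<Rightarrow> (real \<Rightarrow> 'a) set.
            continuous_map
              (prod_topology (top_of_set {0..1}) (cone_topology G N {0<..}))
              (cone_topology G N {0<..}) (\<lambda>(t, x). \<phi> t x) \<and>
            (\<forall>t\<in>{0..1}. lipschitz_hom (asym_cone G N {0<..}) (cone_norm G N {0<..})
                                       (asym_cone G N {0<..}) (cone_norm G N {0<..}) (\<phi> t)) \<and>
            (\<forall>x\<in>carrier (asym_cone G N {0<..}). \<phi> 1 x = x) \<and>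
            (\<forall>x\<in>carrier (asym_cone G N {0<..}). \<phi> 0 x = \<one>\<^bsub>asym_cone G N {0<..}\<^esub>))"
proof (intro conjI impI allI)
  interpret conj_norm_group G N by fact
  fix T assume G: "countable (carrier G)" and T: "scaling_set T"
  interpret asymptotic_cone G N T by unfold_locales (rule T)
  show "separable_top (cone_topology G N T)" by (rule cone_separable[OF G])
  then show "polish_group (asym_cone G N T) (cone_topology G N T)"
    using cone.Q.topological_group cone.Q.M.completely_metrizable_space_mtopology[OF cone_mcomplete]
    by (simp add: polish_group_def)
next
  interpret conj_norm_group G N by fact
  have "\<not> bounded {0::real<..}"
  proof
    assume "bounded {0::real<..}"
    then obtain B where "\<And>x. x \<in> {0::real<..} \<Longrightarrow> norm x \<le> B" unfolding bounded_iff by blast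
    from this[of "\<bar>B\<bar> + 1"] show False by (simp add: add_nonneg_pos)
  qed
  then interpret full_cone G N by unfold_locales (auto simp: scaling_set_def)
  show "contractible_space (cone_topology G N {0<..})" by (rule cone_contractible)
  show "\<exists>\<phi> :: real \<Rightarrow> (real \<Rightarrow> 'a) set \<Rightarrow> (real \<Rightarrow> 'a) set.
      continuous_map (prod_topology (top_of_set {0..1}) (cone_topology G N {0<..}))
        (cone_topology G N {0<..}) (\<lambda>(t, x). \<phi> t x) \<and>
      (\<forall>t\<in>{0..1}. lipschitz_hom (asym_cone G N {0<..}) (cone_norm G N {0<..})
         (asym_cone G N {0<..}) (cone_norm G N {0<..}) (\<phi> t)) \<and>
      (\<forall>x\<in>carrier (asym_cone G N {0<..}). \<phi> 1 x = x) \<and>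
      (\<forall>x\<in>carrier (asym_cone G N {0<..}). \<phi> 0 x = \<one>\<^bsub>asym_cone G N {0<..}\<^esub>)"
    using cone_scale_continuous cone_scale_lipschitz cone_scale_1 cone_scale_0
    by (intro exI[of _ cone_scale]) auto
qed

end
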